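(* Let $\alpha\in\mathbb{Z}_{\ge0}^m$, $T\in\mathrm{KD}(\alpha)$, $k\ge \ell(\alpha)=m$, and $1\le r\le k$. Then \[ \varphi\bigl(T\xleftarrow{\alpha,k} r\bigr)=\varphi(T)\xleftarrow{\mathrm{RSK}} r. \]
   Context: A diagram is a finite set of cells $(c,r)\in\mathbb{Z}_{>0}^2$ (column $c$, row $r$, rows numbered upward). For $\alpha\in\mathbb{Z}_{\ge0}^m$ (of length $\ell(\alpha)=m$), $\mathbb{D}(\alpha)=\{(c,i):1\le c\le\alpha_i\}$. A Kohnert move selects the rightmost cell of some row and moves it down within its column to the nearest vacant position below (jumping over cells), if one exists; $\mathrm{KD}(\alpha)$ is the set of diagrams obtainable from $\mathbb{D}(\alpha)$ by finite sequences of Kohnert moves; a diagram is rectified if it lies in some $\mathrm{KD}(\alpha)$. Threads: start a new thread with the unthreaded cell that is rightmost, and among those lowest; after threading a cell in column $c+1$, thread the lowest unthreaded cell in column $c$ weakly above it, continuing left until column $1$ or until none can be threaded; repeat. For rectified $T$, $\theta(T)_r$ is the number of cells in the thread ending in column $1$, row $r$ (or $0$). A left swap exchanges parts $\alpha_r<\alpha_s$, $r<s$; $\alpha\preceq\beta$ means $\alpha$ is obtained from $\beta$ by finitely many left swaps; a pinned left swap additionally requires $\alpha_r>0$, and $\alpha\preceq^{0}\beta$ means obtained by finitely many pinned left swaps. A labeling assigns positive integers to cells; it is semi-proper of shape $\alpha$ if (i) each column $c$ has distinct entries forming exactly $\{r:\alpha_r\ge c\}$; (ii) entries in row $r$ are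 $\ge r$; (iii) cells with a given entry weakly descend left to right. Pinned: each entry in column $1$ equals its row. $\mathcal{L}_\alpha(T)$ (proper labeling, $T\in\mathrm{KD}(\alpha)$): built right to left, labels $\{i:\alpha_i\ge c\}$ assigned to column $c$ bottom to top, each cell receiving the smallest unused $i$ such that the $i$ in column $c+1$, if any, is weakly lower. $\mathrm{PKD}(\alpha)=\{T\in\mathrm{KD}(\alpha):\mathcal{L}_\alpha(T)\text{ pinned}\}$. Given a semi-proper labeling of shape $\alpha'$, a vacant position $x$ in column $c+1$ abuts label $r$ if the $r$ in column $c$ lies weakly above $x$ and either $\alpha'_r=c$ or the $r$ in column $c+1$ lies strictly below $x$. For $T\in\mathrm{PKD}(\alpha)$ and vacant $x$ weakly below row $k$, $\mathrm{Rect}^{(k)}_\alpha(T,x)$ is: (1) if $T$ has a semi-proper labeling of a shape $\alpha'\preceq^{0}\alpha$ in which $x$ abuts the rightmost $r\le k$, return $T\cup\{x\}$; (2) else if $T$ has such a labeling in which $x$ abuts some $r\le k$, return $\mathrm{Rect}^{(k)}_\alpha(T\cup\{x\}\setminus\{y\},y)$ with $y$ the lowest cell in the column of $x$ for which some such labeling $\mathcal{L}$ has $x$ abut $r\le k$ and $\mathcal{L}(y)=r$; (3) else return $\mathrm{Rect}^{(k)}_\alpha(T,y)$ with $y$ the rightmost vacant position left of $x$ in its row. Insertion: for $T\in\mathrm{KD}(\beta)$ and $1\le r\le k$, $T\xleftarrow{\beta,k}r=\mathrm{Rect}^{(k)}_{\alpha}(T,(c+1,r))$, where $c=\max_i\beta_i$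 and $\alpha$ is maximal such that $\theta(T)\preceq^{0}\alpha\preceq\beta$. Tableaux and $\varphi$: all diagrams and fillings are considered within rows $1,\ldots,N$ for a fixed $N\ge k$. For a diagram $U$ with cells in rows $\le N$, $\varphi(U)$ is the filling in which, for each column $c$ containing $p$ cells of $U$ in rows $i_1>i_2>\cdots>i_p$, the positions $(c,N),(c,N-1),\ldots,(c,N-p+1)$ receive entries $i_1,\ldots,i_p$ (each cell gets its row index as entry and cells are lifted to the top within their column). For $T\in\mathrm{KD}(\alpha)$ this is a semistandard reverse tableau (entries weakly decreasing left to right in rows, strictly decreasing top to bottom in columns) whose shape is the weakly increasing rearrangement of $\alpha$. Reverse RSK row insertion $P\xleftarrow{\mathrm{RSK}}r$: insert $r$ into the top row; if the row contains an entry strictly smaller than $r$, replace the leftmost such entry by $r$ and insert the replaced entry into the next row below by the same rule; otherwise place $r$ at the end of that row and stop. *)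

theory Defs
  imports Main
begin

text \<open>Cells are pairs \<open>(column, row)\<close> with positive coordinates; rows are numbered upward.
  A weak composition of length \<open>m\<close> is a list of length \<open>m\<close>, with parts indexed from 1.\<close>

type_synonym cell = "nat \<times> nat"
type_synonym diagram = "cell set"
type_synonym composition = "nat list"

definition part :: "composition \<Rightarrow> nat \<Rightarrow> nat" where
  "part \<alpha> i = (if 1 \<le> i \<and> i \<le> length \<alpha> then \<alpha> ! (i - 1) else 0)"

definition comp_diagram :: "composition \<Rightarrow> diagram" where
  "comp_diagram \<alpha> = {(c, i). 1 \<le> i \<and> i \<le> length \<alpha> \<and> 1 \<le> c \<and> c \<le> part \<alpha> i}"

definition column :: "diagram \<Rightarrow> nat \<Rightarrow> nat set" where
  "column T c = {i. (c, i) \<in> T}"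


section \<open>Kohnert diagrams\<close>

definition kohnert_move :: "diagram \<Rightarrow> diagram \<Rightarrow> bool" where
  "kohnert_move D D' \<longleftrightarrow> (\<exists>c i j.
     (c, i) \<in> D \<and> (\<forall>c'>c. (c', i) \<notin> D) \<and>
     1 \<le> j \<and> j < i \<and> (c, j) \<notin> D \<and> (\<forall>l. j < l \<and> l < i \<longrightarrow> (c, l) \<in> D) \<and>
     D' = insert (c, j) (D - {(c, i)}))"

definition KD :: "composition \<Rightarrow> diagram set" where
  "KD \<alpha> = {D. kohnert_move\<^sup>*\<^sup>* (comp_diagram \<alpha>) D}"


section \<open>Threads\<close>

text \<open>The thread through \<open>(c, i)\<close> continued to the left, where \<open>U\<close> is the set of cells that were
  unthreaded when the thread was started. A thread meets every column at most once, so \<open>U\<close> need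
  not be updated while the thread is being built.\<close>

fun thread :: "diagram \<Rightarrow> nat \<Rightarrow> nat \<Rightarrow> cell list" where
  "thread U 0 i = [(0, i)]"
| "thread U (Suc c) i = (Suc c, i) #
     (if 1 \<le> c \<and> (\<exists>j\<ge>i. (c, j) \<in> U) then thread U c (LEAST j. i \<le> j \<and> (c, j) \<in> U) else [])"

lemma thread_start: "(c, i) \<in> set (thread U c i)"
  by (cases c) auto

function threads :: "diagram \<Rightarrow> cell list list" where
  "threads U = (if finite U \<and> U \<noteq> {} then
     (let c = Max (fst ` U); t = thread U c (Min (column U c)) in t # threads (U - set t))
   else [])"
  by pat_completeness auto
termination
proof (relation "measure card")
  fix U :: diagram and c t
  assume U: "finite U \<and> U \<noteq> {}" and c: "c = Max (fst ` U)"
    and t: "t = thread U c (Min (column U c))"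
  have "c \<in> fst ` U" using U c by simp
  moreover have "column U c \<subseteq> snd ` U" by (force simp: column_def)
  then have "finite (column U c)" using U finite_subset by blast
  ultimately have "Min (column U c) \<in> column U c"
    by (intro Min_in) (auto simp: column_def)
  then have "(c, Min (column U c)) \<in> U" by (simp add: column_def)
  moreover have "(c, Min (column U c)) \<in> set t" unfolding t by (rule thread_start)
  ultimately have "U - set t \<subset> U" by blast
  then show "(U - set t, U) \<in> measure card" using U by (simp add: psubset_card_mono)
qed simp

declare threads.simps [simp del]

text \<open>The composition \<open>\<theta>(T)\<close>, as a composition of length \<open>m\<close>.\<close>

definition theta :: "nat \<Rightarrow> diagram \<Rightarrow> composition" where
  "theta m T = map (\<lambda>i. case find (\<lambda>t. last t = (1, i)) (threads T) of
                            None \<Rightarrow> 0 | Some t \<Rightarrow> length t) [1..<m + 1]"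


section \<open>Left swaps\<close>

definition left_swap :: "composition \<Rightarrow> composition \<Rightarrow> bool" where
  "left_swap \<beta> \<alpha> \<longleftrightarrow> (\<exists>r s. r < s \<and> s < length \<beta> \<and> \<beta> ! r < \<beta> ! s \<and>
     \<alpha> = \<beta>[r := \<beta> ! s, s := \<beta> ! r])"

definition pinned_left_swap :: "composition \<Rightarrow> composition \<Rightarrow> bool" where
  "pinned_left_swap \<beta> \<alpha> \<longleftrightarrow> (\<exists>r s. r < s \<and> s < length \<beta> \<and> 0 < \<beta> ! r \<and> \<beta> ! r < \<beta> ! s \<and>
     \<alpha> = \<beta>[r := \<beta> ! s, s := \<beta> ! r])"

definition swap_le :: "composition \<Rightarrow> composition \<Rightarrow> bool" (infix "\<preceq>" 50) where
  "\<alpha> \<preceq> \<beta> \<longleftrightarrow> left_swap\<^sup>*\<^sup>* \<beta> \<alpha>"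

definition pinned_swap_le :: "composition \<Rightarrow> composition \<Rightarrow> bool" (infix "\<preceq>\<^sup>0" 50) where
  "\<alpha> \<preceq>\<^sup>0 \<beta> \<longleftrightarrow> pinned_left_swap\<^sup>*\<^sup>* \<beta> \<alpha>"


section \<open>Labelings and rectification\<close>

type_synonym labeling = "cell \<Rightarrow> nat"

definition semi_proper :: "composition \<Rightarrow> diagram \<Rightarrow> labeling \<Rightarrow> bool" where
  "semi_proper \<alpha> T L \<longleftrightarrow>
     (\<forall>c\<ge>1. bij_betw (\<lambda>i. L (c, i)) (column T c) {r. 1 \<le> r \<and> r \<le> length \<alpha> \<and> c \<le> part \<alpha> r}) \<and>
     (\<forall>(c, i) \<in> T. i \<le> L (c, i)) \<and>
     (\<forall>(c, i) \<in> T. \<forall>(c', i') \<in> T. c < c' \<and> L (c, i) = L (c', i') \<longrightarrow> i' \<le> i)"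

text \<open>\<open>abuts \<alpha> T L (c + 1, i) r\<close>. For a position in column 1 the convention is that
  column 0 contains each label \<open>r\<close> in row \<open>r\<close>. For a \<open>T\<close> with a pinned labeling, it makes every
  vacant position of column 1 abut its own row index, so that rectification stops there.\<close>

definition abuts :: "composition \<Rightarrow> diagram \<Rightarrow> labeling \<Rightarrow> cell \<Rightarrow> nat \<Rightarrow> bool" where
  "abuts \<alpha> T L x r \<longleftrightarrow> (case x of (d, i) \<Rightarrow> let c = d - 1 in
     (if c = 0 then i \<le> r else (\<exists>j\<ge>i. (c, j) \<in> T \<and> L (c, j) = r)) \<and>
     (part \<alpha> r = c \<or> (\<exists>j<i. (d, j) \<in> T \<and> L (d, j) = r)))"

text \<open>\<open>Rect k \<alpha> T x\<close>, which is meant for a diagram \<open>T\<close> whose proper labeling of shape \<open>\<alpha>\<close> exists and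
  is pinned, and a vacant \<open>x\<close> weakly below row \<open>k\<close>. In the first case \<open>x\<close> abuts the rightmost \<open>r\<close>,
  i.e. the labeling has no \<open>r\<close> to the right of the column preceding that of \<open>x\<close>. The value is
  \<open>undefined\<close> when neither of the first two cases applies and there is no vacant position to move to.\<close>

function Rect :: "nat \<Rightarrow> composition \<Rightarrow> diagram \<Rightarrow> cell \<Rightarrow> diagram" where
  "Rect k \<alpha> T (d, i) =
     (if \<exists>\<alpha>' L r. \<alpha>' \<preceq>\<^sup>0 \<alpha> \<and> semi_proper \<alpha>' T L \<and> r \<le> k \<and> abuts \<alpha>' T L (d, i) r \<and>
                   part \<alpha>' r = d - 1
      then insert (d, i) T
      else if \<exists>\<alpha>' L r. \<alpha>' \<preceq>\<^sup>0 \<alpha> \<and> semi_proper \<alpha>' T L \<and> r \<le> k \<and> abuts \<alpha>' T L (d, i) r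
      then let j = (LEAST j. (d, j) \<in> T \<and>
                      (\<exists>\<alpha>' L r. \<alpha>' \<preceq>\<^sup>0 \<alpha> \<and> semi_proper \<alpha>' T L \<and> r \<le> k \<and>
                                abuts \<alpha>' T L (d, i) r \<and> L (d, j) = r))
           in Rect k \<alpha> (insert (d, i) T - {(d, j)}) (d, j)
      else if \<exists>c. 1 \<le> c \<and> c < d \<and> (c, i) \<notin> T
      then Rect k \<alpha> T (Max {c. 1 \<le> c \<and> c < d \<and> (c, i) \<notin> T}, i)
      else undefined)"
  by pat_completeness auto
termination
proof (relation "measure (\<lambda>(k, \<alpha>, T, d, i). d + i)", goal_cases)
  case (2 k \<alpha> T d i j)
  then obtain \<alpha>' L r where *: "\<alpha>' \<preceq>\<^sup>0 \<alpha>" "semi_proper \<alpha>' T L" "r \<le> k" "abuts \<alpha>' T L (d, i) r"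
    by blast
  with 2(1) have "part \<alpha>' r \<noteq> d - 1" by blast
  with * obtain l where l: "l < i" "(d, l) \<in> T" "L (d, l) = r"
    by (auto simp: abuts_def Let_def)
  have "j \<le> l" unfolding 2(3) by (rule Least_le) (use * l in blast)
  with l show ?case by simp
next
  case (3 k \<alpha> T d i)
  have "finite {c. 1 \<le> c \<and> c < d \<and> (c, i) \<notin> T}" by simp
  with 3(3) have "Max {c. 1 \<le> c \<and> c < d \<and> (c, i) \<notin> T} \<in> {c. 1 \<le> c \<and> c < d \<and> (c, i) \<notin> T}"
    by (intro Max_in) auto
  then show ?case by simp
qed simp

declare Rect.simps [simp del]

text \<open>The admissible compositions have the zeros of \<open>\<theta>(T)\<close> in common, so maximality with respect to
  \<open>\<preceq>\<close> and to \<open>\<preceq>\<^sup>0\<close> is the same.\<close>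

definition insertion_shape :: "composition \<Rightarrow> diagram \<Rightarrow> composition" where
  "insertion_shape \<beta> T = (SOME \<alpha>. theta (length \<beta>) T \<preceq>\<^sup>0 \<alpha> \<and> \<alpha> \<preceq> \<beta> \<and>
     (\<forall>\<alpha>'. theta (length \<beta>) T \<preceq>\<^sup>0 \<alpha>' \<and> \<alpha>' \<preceq> \<beta> \<and> \<alpha> \<preceq> \<alpha>' \<longrightarrow> \<alpha>' = \<alpha>))"

text \<open>The insertion of \<open>r\<close> into \<open>T \<in> KD \<beta>\<close>; the maximal part of the empty composition
  is taken to be 0.\<close>

definition kd_insert :: "composition \<Rightarrow> nat \<Rightarrow> diagram \<Rightarrow> nat \<Rightarrow> diagram" where
  "kd_insert \<beta> k T r = Rect k (insertion_shape \<beta> T) T (Max (insert 0 (set \<beta>)) + 1, r)"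


section \<open>Fillings and reverse RSK insertion\<close>

text \<open>A filling maps positions \<open>(column, row)\<close> to entries; \<open>None\<close> marks empty positions. The rows
  used are \<open>1, \<dots>, N\<close>, and row \<open>N\<close> is the top row.\<close>

type_synonym filling = "cell \<Rightarrow> nat option"

definition phi :: "nat \<Rightarrow> diagram \<Rightarrow> filling" where
  "phi N U = (\<lambda>(c, i). let rows = rev (sorted_list_of_set (column U c)) in
     if 1 \<le> i \<and> i \<le> N \<and> N - i < length rows then Some (rows ! (N - i)) else None)"

text \<open>Row 0 does not exist: running out of rows below gives \<open>undefined\<close>.\<close>

fun insert_from_row :: "nat \<Rightarrow> filling \<Rightarrow> nat \<Rightarrow> filling" where
  "insert_from_row 0 P r = undefined"
| "insert_from_row (Suc i) P r =
     (if \<exists>c e. P (c, Suc i) = Some e \<and> e < r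
      then let c = (LEAST c. \<exists>e. P (c, Suc i) = Some e \<and> e < r)
           in insert_from_row i (P((c, Suc i) \<mapsto> r)) (the (P (c, Suc i)))
      else P(((LEAST c. 1 \<le> c \<and> (\<forall>c'\<ge>c. P (c', Suc i) = None)), Suc i) \<mapsto> r))"

definition rsk_insert :: "nat \<Rightarrow> filling \<Rightarrow> nat \<Rightarrow> filling" where
  "rsk_insert N P r = insert_from_row N P r"

end

theory Submission
  imports Defs
begin

text \<open>Everything is controlled by the numbers \<open>above (column T c) z\<close> of cells of column \<open>c\<close> weakly above
  row \<open>z\<close>. On the side of rectification, a vacant position \<open>(d, v)\<close> abuts a label of some admissible
  labeling exactly if column \<open>d - 1\<close> has more cells weakly above \<open>v\<close> than column \<open>d\<close>. On the side of
  RSK, the value \<open>v\<close> enters row \<open>N - above (column T d) v\<close>, and the same inequality says that it ends up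
  in column \<open>d\<close>. If the two numbers are equal, \<open>v\<close> enters the same row when it is moved to column
  \<open>d - 1\<close>, which is the third case of \<open>Rect\<close>. One step of \<open>Rect\<close> may correspond to several bumps
  within one column.

  This only needs some semi-proper labeling of a shape \<open>\<preceq>\<^sup>0\<close> the insertion shape. The threads of \<open>T\<close>
  provide one of shape \<open>\<theta>(T)\<close>, and \<open>\<theta>(T) \<preceq> \<beta>\<close> because threads are greedy.\<close>

section \<open>Dominance of finite sets of rows\<close>

text \<open>\<open>Rect\<close> searches through all semi-proper labelings of all admissible shapes;
  \<open>slack\<close> replaces this search. Abutting means that some label occurs weakly above
  \<open>v\<close> in column \<open>d - 1\<close> but not in column \<open>d\<close>. For any
  labeling these label sets are nested, so a difference in size exposes such a label. Hence a single
  labeling decides every branch, and it suffices to keep one alive: the label of an ejected cell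
  passes to the position just filled.

  Several bumps can match one step because the abutting label sits weakly above \<open>v\<close> in
  column \<open>d - 1\<close> and at the ejected cell \<open>y\<close> in column \<open>d\<close>.
  The inequality thus holds at every threshold above \<open>y\<close> up to \<open>v\<close>; the
  entries in between bump one another down to \<open>y\<close>, and the net change is
  \<open>v\<close> for \<open>y\<close>.

  A starting labeling has to be found for a diagram known only through its Kohnert moves. What is
  followed through the moves is weaker: for each column separately, a chain of dominating sets
  leading to its labels in \<beta>. Threads end no higher than such a chain, and a Bruhat-type
  criterion turns this dominance, level by level, into left swaps.\<close>

definition above :: "nat set \<Rightarrow> nat \<Rightarrow> nat" where
  "above S z = card {x \<in> S. z \<le> x}"

text \<open>For finite sets this is Hall's condition for an injection from \<open>S\<close> into
  \<open>S'\<close> that never moves an element down. Counts are easier to update than a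
  matching.\<close>

definition dom_le :: "nat set \<Rightarrow> nat set \<Rightarrow> bool" where
  "dom_le S S' \<longleftrightarrow> (\<forall>z. above S z \<le> above S' z)"

lemma dom_le_refl [simp]: "dom_le S S"
  by (simp add: dom_le_def)

lemma dom_le_trans: "dom_le A B \<Longrightarrow> dom_le B C \<Longrightarrow> dom_le A C"
  unfolding dom_le_def using le_trans by blast

lemma above_antimono: "finite S \<Longrightarrow> z \<le> z' \<Longrightarrow> above S z' \<le> above S z"
  unfolding above_def by (intro card_mono) auto

lemma above_mono: "finite S' \<Longrightarrow> S \<subseteq> S' \<Longrightarrow> above S z \<le> above S' z"
  unfolding above_def by (intro card_mono) auto

lemma above_0 [simp]: "above S 0 = card S"
  by (simp add: above_def)

lemma above_insert: "finite S \<Longrightarrow> x \<notin> S \<Longrightarrow> above (insert x S) z = above S z + (if z \<le> x then 1 else 0)"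
proof -
  assume "finite S" "x \<notin> S"
  moreover have "{y \<in> insert x S. z \<le> y} = (if z \<le> x then insert x {y \<in> S. z \<le> y} else {y \<in> S. z \<le> y})"
    by auto
  ultimately show ?thesis by (simp add: above_def)
qed

lemma above_remove: "finite S \<Longrightarrow> x \<in> S \<Longrightarrow> above S z = above (S - {x}) z + (if z \<le> x then 1 else 0)"
  using above_insert[of "S - {x}" x z] by (simp add: insert_absorb)

lemma above_Suc: "finite S \<Longrightarrow> above S z = above S (Suc z) + (if z \<in> S then 1 else 0)"
proof -
  assume "finite S"
  moreover have "{x \<in> S. z \<le> x} = (if z \<in> S then insert z {x \<in> S. Suc z \<le> x} else {x \<in> S. Suc z \<le> x})"
    by (auto simp: le_less Suc_le_eq)
  ultimately show ?thesis by (simp add: above_def)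
qed

lemma above_pos_iff: "finite S \<Longrightarrow> 0 < above S z \<longleftrightarrow> (\<exists>x\<in>S. z \<le> x)"
  by (auto simp: above_def card_gt_0_iff)

lemma above_eq_gap:
  assumes "\<And>x. x \<in> S \<Longrightarrow> z \<le> x \<Longrightarrow> z' \<le> x" and "z \<le> z'"
  shows "above S z = above S z'"
proof -
  have "{x \<in> S. z \<le> x} = {x \<in> S. z' \<le> x}" using assms by auto
  then show ?thesis by (simp add: above_def)
qed

text \<open>Only thresholds \<open>z\<close> with \<open>e < z\<close> and \<open>z \<le> e'\<close>
  are critical, where \<open>S'\<close> alone loses an element. There \<open>S'\<close> counts as
  many elements at \<open>z\<close> as at \<open>i\<close>, while \<open>S\<close> counts strictly
  fewer at \<open>z\<close> than at \<open>i\<close>, because of \<open>e\<close>.\<close>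

lemma dom_le_remove_least:
  assumes fin: "finite S" "finite S'" and dom: "dom_le S S'"
    and e: "e \<in> S" "i \<le> e" "\<And>x. x \<in> S \<Longrightarrow> i \<le> x \<Longrightarrow> e \<le> x"
    and e': "e' \<in> S'" "i \<le> e'" "\<And>x. x \<in> S' \<Longrightarrow> i \<le> x \<Longrightarrow> e' \<le> x"
  shows "dom_le (S - {e}) (S' - {e'})"
  unfolding dom_le_def
proof
  fix z
  have le: "above S z \<le> above S' z" and le_i: "above S i \<le> above S' i"
    using dom by (auto simp: dom_le_def)
  have r: "above S z = above (S - {e}) z + (if z \<le> e then 1 else 0)"
    and r': "above S' z = above (S' - {e'}) z + (if z \<le> e' then 1 else 0)"
    using above_remove fin e(1) e'(1) by auto
  show "above (S - {e}) z \<le> above (S' - {e'}) z"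
  proof (cases "e < z \<and> z \<le> e'")
    case False
    then show ?thesis using r r' le by (auto split: if_splits)
  next
    case True
    have "above S' i = above S' z"
      using True e(2) e'(3) by (intro above_eq_gap) (force, simp)
    moreover have "above S z < above S i"
    proof -
      have "above S z \<le> above S (Suc e)" using True fin by (intro above_antimono) auto
      also have "\<dots> < above S e" using above_Suc[of S e] fin e by simp
      also have "\<dots> \<le> above S i" using fin e by (intro above_antimono) auto
      finally show ?thesis .
    qed
    ultimately show ?thesis using r r' le_i True by simp
  qed
qed

lemma dom_leD_ex:
  assumes "finite S" "finite S'" "dom_le S S'" "x \<in> S" "i \<le> x"
  shows "\<exists>x'\<in>S'. i \<le> x'"
proof -
  have "0 < above S i" using assms above_pos_iff by blast
  then have "0 < above S' i" using assms(3) by (metis dom_le_def less_le_trans)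
  then show ?thesis using assms(2) above_pos_iff by blast
qed


section \<open>Left swaps and dominance of compositions\<close>

definition parts_ge :: "composition \<Rightarrow> nat \<Rightarrow> nat set" where
  "parts_ge \<alpha> c = {i. i < length \<alpha> \<and> c \<le> \<alpha> ! i}"

lemma finite_parts_ge [simp]: "finite (parts_ge \<alpha> c)"
  by (simp add: parts_ge_def)

lemma mem_parts_ge: "i \<in> parts_ge \<alpha> c \<longleftrightarrow> i < length \<alpha> \<and> c \<le> \<alpha> ! i"
  by (simp add: parts_ge_def)

text \<open>A left swap lowers it, since the larger part moves to the lower position. It drives the
  induction for the swap criterion and yields maximal insertion shapes.\<close>

definition weight :: "composition \<Rightarrow> nat" where
  "weight \<alpha> = (\<Sum>i<length \<alpha>. i * \<alpha> ! i)"

lemma left_swap_weight: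
  assumes "left_swap \<beta> \<alpha>"
  shows "weight \<alpha> < weight \<beta>"
proof -
  obtain r s where rs: "r < s" "s < length \<beta>" "\<beta> ! r < \<beta> ! s" "\<alpha> = \<beta>[r := \<beta> ! s, s := \<beta> ! r]"
    using assms by (auto simp: left_swap_def)
  let ?I = "{..<length \<beta>} - {s} - {r}"
  have split: "(\<Sum>i<length \<beta>. f i) = f s + (f r + (\<Sum>i\<in>?I. f i))" for f :: "nat \<Rightarrow> nat"
    using rs by (simp add: sum.remove[of _ s] sum.remove[of _ r])
  have "weight \<alpha> = s * \<beta> ! r + (r * \<beta> ! s + (\<Sum>i\<in>?I. i * \<beta> ! i))"
    unfolding weight_def using rs split[of "\<lambda>i. i * \<alpha> ! i"] by (simp add: nth_list_update)
  moreover have "weight \<beta> = s * \<beta> ! s + (r * \<beta> ! r + (\<Sum>i\<in>?I. i * \<beta> ! i))"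
    unfolding weight_def by (rule split)
  moreover have "s * \<beta> ! r + r * \<beta> ! s < s * \<beta> ! s + r * \<beta> ! r"
  proof -
    obtain u v where "s = r + Suc u" "\<beta> ! s = \<beta> ! r + Suc v"
      using rs(1,3) less_iff_Suc_add by auto
    then show ?thesis by (simp add: algebra_simps)
  qed
  ultimately show ?thesis by simp
qed

lemma swap_le_weight: "\<alpha> \<preceq> \<beta> \<Longrightarrow> \<alpha> \<noteq> \<beta> \<Longrightarrow> weight \<alpha> < weight \<beta>"
  unfolding swap_le_def
  by (induction rule: rtranclp_induct) (use left_swap_weight in \<open>auto dest: less_trans\<close>)

text \<open>A form of the tableau criterion for Bruhat order, for words with repeated letters. At
  the topmost disagreement \<open>s\<close> dominance forces \<beta> to have the larger part; one
  swap of \<open>s\<close> with a lower position keeps the dominance and lowers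
  \<open>weight\<close>.\<close>

lemma swap_le_if_dom_le:
  assumes "length \<alpha> = length \<beta>"
    and "\<And>c. dom_le (parts_ge \<alpha> c) (parts_ge \<beta> c)"
    and "\<And>c. card (parts_ge \<alpha> c) = card (parts_ge \<beta> c)"
  shows "\<alpha> \<preceq> \<beta>"
  using assms
proof (induction "weight \<beta>" arbitrary: \<beta> rule: less_induct)
  case less
  note len = less.prems(1)
  have dom: "above (parts_ge \<alpha> c) z \<le> above (parts_ge \<beta> c) z" for c z
    using less.prems(2) by (simp add: dom_le_def)
  show ?case
  proof (cases "\<alpha> = \<beta>")
    case True
    then show ?thesis by (simp add: swap_le_def)
  next
    case False
    define D where "D = {i. i < length \<beta> \<and> \<alpha> ! i \<noteq> \<beta> ! i}"
    have "D \<noteq> {}" "finite D" using False len nth_equalityI[of \<alpha> \<beta>] by (auto simp: D_def)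
    define s where "s = Max D"
    have "s \<in> D" using \<open>D \<noteq> {}\<close> \<open>finite D\<close> by (simp add: s_def)
    then have s: "s < length \<beta>" "\<alpha> ! s \<noteq> \<beta> ! s" by (auto simp: D_def)
    have tail: "\<alpha> ! i = \<beta> ! i" if "s < i" "i < length \<beta>" for i
    proof (rule ccontr)
      assume "\<alpha> ! i \<noteq> \<beta> ! i"
      then have "i \<in> D" using that by (simp add: D_def)
      then show False using Max_ge[OF \<open>finite D\<close>] that by (fastforce simp: s_def)
    qed
    have tail_eq: "above (parts_ge \<alpha> c) (Suc s) = above (parts_ge \<beta> c) (Suc s)" for c
    proof -
      have "{x \<in> parts_ge \<alpha> c. Suc s \<le> x} = {x \<in> parts_ge \<beta> c. Suc s \<le> x}"
        using tail len by (auto simp: parts_ge_def)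
      then show ?thesis by (simp add: above_def)
    qed
    have "\<alpha> ! s < \<beta> ! s"
    proof (rule ccontr)
      assume "\<not> \<alpha> ! s < \<beta> ! s"
      then have "\<beta> ! s < \<alpha> ! s" using s by simp
      then have "above (parts_ge \<alpha> (\<alpha> ! s)) s = Suc (above (parts_ge \<beta> (\<alpha> ! s)) s)"
        using above_Suc[of "parts_ge \<alpha> (\<alpha> ! s)" s] above_Suc[of "parts_ge \<beta> (\<alpha> ! s)" s]
          tail_eq s len by (simp add: mem_parts_ge)
      then show False using dom[of "\<alpha> ! s" s] by simp
    qed
    \<comment> \<open>Swapping the last position in \<open>M\<close> with \<open>s\<close> keeps the dominance over \<open>\<alpha>\<close>, since no part
      strictly between the two lies in the interval from \<open>\<alpha> ! s\<close> to \<open>\<beta> ! s\<close>.\<close>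
    define M where "M = {i. i < s \<and> \<alpha> ! s \<le> \<beta> ! i \<and> \<beta> ! i < \<beta> ! s}"
    \<comment> \<open>If \<open>M\<close> were empty, \<beta> would have equally many parts below
      \<open>s\<close> at the levels \<open>\<alpha> ! s\<close> and \<open>\<beta> ! s\<close>.
      Equal totals would then give \<alpha> one more part below \<open>s\<close> at the higher level
      than at the lower one.\<close>
    have "M \<noteq> {}"
    proof
      assume "M = {}"
      have low: "above (parts_ge \<gamma> c) 0 = card {i. i < s \<and> c \<le> \<gamma> ! i} + above (parts_ge \<gamma> c) s"
        if "length \<gamma> = length \<beta>" for \<gamma> c
      proof -
        have "parts_ge \<gamma> c = {i. i < s \<and> c \<le> \<gamma> ! i} \<union> {x \<in> parts_ge \<gamma> c. s \<le> x}"
          using s that by (auto simp: parts_ge_def)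
        moreover have "card ({i. i < s \<and> c \<le> \<gamma> ! i} \<union> {x \<in> parts_ge \<gamma> c. s \<le> x})
          = card {i. i < s \<and> c \<le> \<gamma> ! i} + above (parts_ge \<gamma> c) s"
          unfolding above_def by (intro card_Un_disjoint) auto
        ultimately show ?thesis by simp
      qed
      let ?L = "\<lambda>\<gamma> c. card {i. i < s \<and> c \<le> \<gamma> ! i}"
      have "\<alpha> ! s \<le> \<beta> ! i \<longleftrightarrow> \<beta> ! s \<le> \<beta> ! i" if "i < s" for i
      proof -
        have "i \<notin> M" using \<open>M = {}\<close> by simp
        then show ?thesis using that \<open>\<alpha> ! s < \<beta> ! s\<close> by (auto simp: M_def)
      qed
      then have "?L \<beta> (\<alpha> ! s) = ?L \<beta> (\<beta> ! s)"
        by (intro arg_cong[of _ _ card]) auto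
      moreover have "?L \<alpha> (\<beta> ! s) \<le> ?L \<alpha> (\<alpha> ! s)"
        using \<open>\<alpha> ! s < \<beta> ! s\<close> by (intro card_mono) auto
      moreover have tot: "?L \<alpha> c + above (parts_ge \<alpha> c) s = ?L \<beta> c + above (parts_ge \<beta> c) s" for c
        using low[of \<alpha> c] low[of \<beta> c] less.prems(3)[of c] len by simp
      note tot[of "\<alpha> ! s"] tot[of "\<beta> ! s"]
      moreover have "above (parts_ge \<alpha> (\<alpha> ! s)) s = above (parts_ge \<beta> (\<alpha> ! s)) s"
        "Suc (above (parts_ge \<alpha> (\<beta> ! s)) s) = above (parts_ge \<beta> (\<beta> ! s)) s"
        using above_Suc[OF finite_parts_ge, of \<alpha> _ s] above_Suc[OF finite_parts_ge, of \<beta> _ s]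
          tail_eq s len \<open>\<alpha> ! s < \<beta> ! s\<close> by (simp_all add: mem_parts_ge)
      ultimately show False by linarith
    qed
    have "finite M" by (simp add: M_def)
    define r where "r = Max M"
    have "r \<in> M" using \<open>M \<noteq> {}\<close> \<open>finite M\<close> by (simp add: r_def)
    then have r: "r < s" "\<alpha> ! s \<le> \<beta> ! r" "\<beta> ! r < \<beta> ! s" by (auto simp: M_def)
    have gap: "\<beta> ! s \<le> \<beta> ! i" if "r < i" "i < s" "\<alpha> ! s \<le> \<beta> ! i" for i
    proof (rule ccontr)
      assume "\<not> \<beta> ! s \<le> \<beta> ! i"
      then have "i \<in> M" using that by (simp add: M_def)
      then show False using Max_ge[OF \<open>finite M\<close>] that by (fastforce simp: r_def)
    qed
    define \<beta>' where "\<beta>' = \<beta>[r := \<beta> ! s, s := \<beta> ! r]"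
    have swap: "left_swap \<beta> \<beta>'" unfolding left_swap_def \<beta>'_def using r s by blast
    have len': "length \<beta>' = length \<beta>" by (simp add: \<beta>'_def)
    have nth': "\<beta>' ! i = (if i = s then \<beta> ! r else if i = r then \<beta> ! s else \<beta> ! i)"
      if "i < length \<beta>" for i
      using that r s by (auto simp: \<beta>'_def nth_list_update)
    have pg': "parts_ge \<beta>' c = (if \<beta> ! r < c \<and> c \<le> \<beta> ! s then insert r (parts_ge \<beta> c - {s}) else parts_ge \<beta> c)" for c
      using r s len' by (auto simp: parts_ge_def nth' split: if_splits)
    have above': "above (parts_ge \<beta>' c) z + (if z \<le> s then 1 else 0) = above (parts_ge \<beta> c) z + (if z \<le> r then 1 else 0)"
      if c: "\<beta> ! r < c" "c \<le> \<beta> ! s" for c z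
    proof -
      have "s \<in> parts_ge \<beta> c" "r \<notin> parts_ge \<beta> c" using c r s by (auto simp: parts_ge_def)
      then show ?thesis
        using above_remove[of "parts_ge \<beta> c" s z] above_insert[of "parts_ge \<beta> c - {s}" r z] c r(1)
        by (auto simp: pg')
    qed
    have "\<alpha> \<preceq> \<beta>'"
    proof (rule less.hyps)
      show "weight \<beta>' < weight \<beta>" using swap by (rule left_swap_weight)
      show "length \<alpha> = length \<beta>'" using len len' by simp
      show "card (parts_ge \<alpha> c) = card (parts_ge \<beta>' c)" for c
        using less.prems(3)[of c] above'[of c 0] by (cases "\<beta> ! r < c \<and> c \<le> \<beta> ! s") (auto simp: pg')
      show "dom_le (parts_ge \<alpha> c) (parts_ge \<beta>' c)" for c
        unfolding dom_le_def
      proof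
        fix z
        show "above (parts_ge \<alpha> c) z \<le> above (parts_ge \<beta>' c) z"
        \<comment> \<open>In this range of levels and thresholds the swap costs one. Between
          \<open>z\<close> and \<open>s\<close>, \<beta> has the same positions at level
          \<open>c\<close> as at level \<open>\<alpha> ! s\<close>, by \<open>gap\<close>, whereas
          \<alpha> loses \<open>s\<close>. So dominance at level \<open>\<alpha> ! s\<close> becomes
          strict at level \<open>c\<close>.\<close>
        proof (cases "\<beta> ! r < c \<and> c \<le> \<beta> ! s \<and> r < z \<and> z \<le> s")
          case False
          then show ?thesis
            using dom[of c z] above'[of c z] by (cases "\<beta> ! r < c \<and> c \<le> \<beta> ! s") (auto simp: pg' split: if_splits)
        next
          case True
          have "{x \<in> parts_ge \<beta> (\<alpha> ! s). z \<le> x \<and> x \<le> s} = {x \<in> parts_ge \<beta> c. z \<le> x \<and> x \<le> s}"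
          proof (rule Collect_cong)
            fix x
            show "x \<in> parts_ge \<beta> (\<alpha> ! s) \<and> z \<le> x \<and> x \<le> s \<longleftrightarrow> x \<in> parts_ge \<beta> c \<and> z \<le> x \<and> x \<le> s"
              using True r gap[of x] by (cases "x = s") (auto simp: mem_parts_ge)
          qed
          moreover have "{x \<in> parts_ge \<alpha> c. z \<le> x \<and> x \<le> s} \<subset> {x \<in> parts_ge \<alpha> (\<alpha> ! s). z \<le> x \<and> x \<le> s}"
          proof (rule psubsetI)
            have "s \<notin> parts_ge \<alpha> c" "s \<in> parts_ge \<alpha> (\<alpha> ! s)" 
              using True r s len by (auto simp: parts_ge_def)
            then show "{x \<in> parts_ge \<alpha> c. z \<le> x \<and> x \<le> s} \<noteq> {x \<in> parts_ge \<alpha> (\<alpha> ! s). z \<le> x \<and> x \<le> s}"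
              using True by blast
          qed (use True r in \<open>auto simp: parts_ge_def\<close>)
          then have "card {x \<in> parts_ge \<alpha> c. z \<le> x \<and> x \<le> s} < card {x \<in> parts_ge \<alpha> (\<alpha> ! s). z \<le> x \<and> x \<le> s}"
            by (intro psubset_card_mono) auto
          moreover have split: "above (parts_ge \<gamma> b) z = card {x \<in> parts_ge \<gamma> b. z \<le> x \<and> x \<le> s} + above (parts_ge \<gamma> b) (Suc s)" for \<gamma> b
          proof -
            have "{x \<in> parts_ge \<gamma> b. z \<le> x} = {x \<in> parts_ge \<gamma> b. z \<le> x \<and> x \<le> s} \<union> {x \<in> parts_ge \<gamma> b. Suc s \<le> x}"
              using True by auto
            then show ?thesis unfolding above_def
              by (simp only:) (rule card_Un_disjoint; auto)
          qed
          ultimately have "above (parts_ge \<alpha> c) z < above (parts_ge \<beta> c) z"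
            using dom[of "\<alpha> ! s" z] tail_eq[of c] tail_eq[of "\<alpha> ! s"]
            by (simp only: split)
          then show ?thesis using above'[of c z] True by simp
        qed
      qed
    qed
    then show ?thesis
      using swap by (simp add: swap_le_def converse_rtranclp_into_rtranclp)
  qed
qed


section \<open>The thread labeling\<close>

text \<open>Each column can be matched weakly upward into the one on its left. This carries every
  thread to column 1 and survives the removal of a thread.\<close>

definition hall :: "diagram \<Rightarrow> bool" where
  "hall U \<longleftrightarrow> finite U \<and> (\<forall>(c, i) \<in> U. 1 \<le> c) \<and>
     (\<forall>c\<ge>1. dom_le (column U (Suc c)) (column U c))"

lemma finite_column [simp]: "finite U \<Longrightarrow> finite (column U c)"
  by (rule finite_subset[of _ "snd ` U"]) (force simp: column_def)+

lemma mem_column: "i \<in> column U c \<longleftrightarrow> (c, i) \<in> U"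
  by (simp add: column_def)

text \<open>\<open>g k\<close> is the row of the thread in column \<open>k\<close>. Domination
  always provides a cell to continue with, so \<open>thread\<close> stops at column 1 only.\<close>

lemma thread_path:
  assumes "hall U" "(c, i) \<in> U" "1 \<le> c"
  shows "\<exists>g. g c = i \<and> set (thread U c i) = (\<lambda>k. (k, g k)) ` {1..c} \<and> length (thread U c i) = c \<and>
    last (thread U c i) = (1, g 1) \<and> (\<forall>k\<in>{1..c}. g k \<in> column U k) \<and>
    (\<forall>k. 1 \<le> k \<and> k < c \<longrightarrow> g (Suc k) \<le> g k \<and> (\<forall>x\<in>column U k. g (Suc k) \<le> x \<longrightarrow> g k \<le> x))"
  using assms(2,3)
proof (induction c arbitrary: i)
  case (Suc c)
  show ?case
  proof (cases "c = 0")
    case True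
    with Suc.prems show ?thesis
      by (intro exI[of _ "\<lambda>_. i"]) (auto simp: mem_column)
  next
    case False
    have "\<exists>j\<in>column U c. i \<le> j"
      using assms(1) Suc.prems False
      by (intro dom_leD_ex[of "column U (Suc c)" _ i]) (auto simp: hall_def mem_column)
    then have ex: "\<exists>j. i \<le> j \<and> (c, j) \<in> U" by (auto simp: mem_column)
    define j where "j = (LEAST j. i \<le> j \<and> (c, j) \<in> U)"
    have j: "i \<le> j" "(c, j) \<in> U" using LeastI_ex[OF ex] by (auto simp: j_def)
    have j_least: "j \<le> x" if "x \<in> column U c" "i \<le> x" for x
      unfolding j_def using that by (intro Least_le) (simp add: mem_column)
    obtain g where g: "g c = j" "set (thread U c j) = (\<lambda>k. (k, g k)) ` {1..c}"
      "length (thread U c j) = c" "last (thread U c j) = (1, g 1)" "\<forall>k\<in>{1..c}. g k \<in> column U k"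
      "\<forall>k. 1 \<le> k \<and> k < c \<longrightarrow> g (Suc k) \<le> g k \<and> (\<forall>x\<in>column U k. g (Suc k) \<le> x \<longrightarrow> g k \<le> x)"
      using Suc.IH[OF j(2)] False by auto
    have unfold: "thread U (Suc c) i = (Suc c, i) # thread U c j"
      using ex False by (auto simp: j_def)
    have "{1..Suc c} = insert (Suc c) {1..c}" by auto
    then have "set (thread U (Suc c) i) = (\<lambda>k. (k, (g(Suc c := i)) k)) ` {1..Suc c}"
      unfolding unfold by (auto simp: g(2) image_iff)
    moreover have "last (thread U (Suc c) i) = (1, g 1)"
      using g(3,4) False unfolding unfold by auto
    ultimately show ?thesis
      using g(1,3,5,6) Suc.prems False j j_least unfolding unfold
      by (intro exI[of _ "g(Suc c := i)"]) (auto simp: mem_column less_Suc_eq le_Suc_eq)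
  qed
qed simp

lemma first_thread:
  assumes U: "hall U" "U \<noteq> {}" and c: "c = Max (fst ` U)" and t: "t = thread U c (Min (column U c))"
  shows "\<exists>g. set t = (\<lambda>k. (k, g k)) ` {1..c} \<and> length t = c \<and> last t = (1, g 1) \<and> 1 \<le> c \<and>
    (\<forall>k\<in>{1..c}. g k \<in> column U k) \<and>
    (\<forall>k. 1 \<le> k \<and> k < c \<longrightarrow> g (Suc k) \<le> g k \<and> (\<forall>x\<in>column U k. g (Suc k) \<le> x \<longrightarrow> g k \<le> x)) \<and>
    (\<forall>k>c. column U k = {}) \<and> hall (U - set t)"
proof -
  have fin: "finite U" using U by (simp add: hall_def)
  have "c \<in> fst ` U" using fin U(2) c by simp
  then have ne: "column U c \<noteq> {}" by (auto simp: column_def)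
  then have "Min (column U c) \<in> column U c" using fin by simp
  then have start: "(c, Min (column U c)) \<in> U" by (simp add: mem_column)
  then have c1: "1 \<le> c" using U(1) by (auto simp: hall_def)
  obtain g where g: "g c = Min (column U c)" "set t = (\<lambda>k. (k, g k)) ` {1..c}"
    "length t = c" "last t = (1, g 1)" "\<forall>k\<in>{1..c}. g k \<in> column U k"
    "\<forall>k. 1 \<le> k \<and> k < c \<longrightarrow> g (Suc k) \<le> g k \<and> (\<forall>x\<in>column U k. g (Suc k) \<le> x \<longrightarrow> g k \<le> x)"
    using thread_path[OF U(1) start c1] unfolding t by blast
  have empty: "column U k = {}" if "k > c" for k
  proof (rule ccontr)
    assume "column U k \<noteq> {}"
    then have "k \<in> fst ` U" by (force simp: column_def)
    then have "k \<le> c" unfolding c using fin by (intro Max_ge) auto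
    then show False using that by simp
  qed
  have col: "column (U - set t) k = (if k \<in> {1..c} then column U k - {g k} else column U k)" for k
    unfolding column_def g(2) by auto
  have "dom_le (column (U - set t) (Suc k)) (column (U - set t) k)" if k: "1 \<le> k" for k
  proof (cases "k < c")
    case False
    then show ?thesis using k empty[of "Suc k"] by (simp add: col dom_le_def above_def)
  next
    case True
    \<comment> \<open>The threshold is \<open>g (Suc k)\<close> itself; the greedy choice makes
      \<open>g k\<close> the least cell of column \<open>k\<close> weakly above it.\<close>
    have "dom_le (column U (Suc k) - {g (Suc k)}) (column U k - {g k})"
      using U(1) fin True k g(5) g(6)
      by (intro dom_le_remove_least[of _ _ _ "g (Suc k)"]) (auto simp: hall_def)
    then show ?thesis using True k by (simp add: col)
  qed
  then have "hall (U - set t)" using U(1) by (auto simp: hall_def)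
  then show ?thesis using g empty c1 by (intro exI[of _ g]) blast
qed

text \<open>The parts of \<open>theta\<close> without the cut to a fixed length, which suits an
  induction over the list of threads.\<close>

definition thread_length :: "cell list list \<Rightarrow> nat \<Rightarrow> nat" where
  "thread_length ts r = (case find (\<lambda>t. last t = (1, r)) ts of None \<Rightarrow> 0 | Some t \<Rightarrow> length t)"

lemma thread_length_Nil [simp]: "thread_length [] r = 0"
  by (simp add: thread_length_def)

lemma thread_length_Cons:
  "thread_length (t # ts) r = (if last t = (1, r) then length t else thread_length ts r)"
  by (simp add: thread_length_def)

lemma threads_empty [simp]: "threads {} = []"
  by (simp add: threads.simps)

text \<open>Each cell is labeled by the row in which its thread ends. Threads weakly descend from
  left to right, which gives both order conditions. The last conjunct, pinnedness, identifies the
  support of \<open>theta\<close>.\<close>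

lemma threads_labeling:
  assumes "hall U"
  shows "\<exists>L. (\<forall>c\<ge>1. bij_betw (\<lambda>i. L (c, i)) (column U c) {r. c \<le> thread_length (threads U) r}) \<and>
     (\<forall>(c, i) \<in> U. i \<le> L (c, i)) \<and>
     (\<forall>(c, i) \<in> U. \<forall>(c', i') \<in> U. c < c' \<and> L (c, i) = L (c', i') \<longrightarrow> i' \<le> i) \<and>
     (\<forall>i\<in>column U 1. L (1, i) = i)"
  using assms
proof (induction U rule: threads.induct)
  case (1 U)
  show ?case
  proof (cases "U = {}")
    case True
    then show ?thesis by (simp add: column_def bij_betw_def)
  next
    case False
    define c where "c = Max (fst ` U)"
    define t where "t = thread U c (Min (column U c))"
    define U' where "U' = U - set t"
    have fin: "finite U" using 1 by (simp add: hall_def)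
    obtain g where g: "set t = (\<lambda>k. (k, g k)) ` {1..c}" "length t = c" "last t = (1, g 1)" "1 \<le> c"
      "\<forall>k\<in>{1..c}. g k \<in> column U k"
      "\<forall>k. 1 \<le> k \<and> k < c \<longrightarrow> g (Suc k) \<le> g k \<and> (\<forall>x\<in>column U k. g (Suc k) \<le> x \<longrightarrow> g k \<le> x)"
      and hall': "hall U'"
      using first_thread[OF 1(2) False c_def t_def] U'_def by blast
    have thr: "threads U = t # threads U'"
      using fin False by (simp add: threads.simps[of U] Let_def c_def t_def U'_def)
    obtain L where bij: "\<And>c. c \<ge> 1 \<Longrightarrow> bij_betw (\<lambda>i. L (c, i)) (column U' c) {r. c \<le> thread_length (threads U') r}"
      and ge: "\<forall>(c, i) \<in> U'. i \<le> L (c, i)"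
      and desc: "\<forall>(c, i) \<in> U'. \<forall>(c', i') \<in> U'. c < c' \<and> L (c, i) = L (c', i') \<longrightarrow> i' \<le> i"
      and pin: "\<forall>i\<in>column U' 1. L (1, i) = i"
      using 1(1)[of c t] fin False c_def t_def hall' U'_def by blast
    have "bij_betw (\<lambda>i. i) (column U' 1) {r. 1 \<le> thread_length (threads U') r}"
      using bij[of 1] bij_betw_cong[of "column U' 1" "\<lambda>i. L (1, i)" "\<lambda>i. i"] pin by simp
    then have supp: "{r. 1 \<le> thread_length (threads U') r} = column U' 1" by (simp add: bij_betw_def)
    \<comment> \<open>No later thread ends in row \<open>g 1\<close>, as that cell has left column
      1. So the label \<open>g 1\<close> is new in every column met by the first thread.\<close>
    have g1: "c \<le> thread_length (threads U') (g 1) \<Longrightarrow> c = 0" for c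
    proof (rule ccontr)
      assume "c \<le> thread_length (threads U') (g 1)" "c \<noteq> 0"
      then have "g 1 \<in> {r. 1 \<le> thread_length (threads U') r}" by simp
      then have "g 1 \<in> column U' 1" unfolding supp .
      then show False using g(1,4) by (auto simp: mem_column U'_def)
    qed
    have tl: "{r. k \<le> thread_length (threads U) r} = 
      (if k \<in> {1..c} then insert (g 1) {r. k \<le> thread_length (threads U') r} else {r. k \<le> thread_length (threads U') r})"
      if "1 \<le> k" for k
      using g(2,3) g1[of k] that by (auto simp: thr thread_length_Cons)
    have col: "column U k = (if k \<in> {1..c} then insert (g k) (column U' k) else column U' k)" for k
      using g(1,5) by (auto simp: column_def U'_def)
    have gU': "(k, g k) \<notin> U'" if "k \<in> {1..c}" for k
      using that g(1) by (auto simp: U'_def)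
    have g_anti: "g k' \<le> g k" if "1 \<le> k" "k \<le> k'" "k' \<le> c" for k k'
      using that(2,3)
    proof (induction k' rule: dec_induct)
      case (step n)
      then show ?case using g(6)[rule_format, of n] that(1) by simp
    qed simp
    define L' where "L' = (\<lambda>x. if x \<in> set t then g 1 else L x)"
    have L't: "L' (k, g k) = g 1" if "k \<in> {1..c}" for k
      using that g(1) by (auto simp: L'_def)
    have L'U: "L' x = L x" if "x \<in> U'" for x using that by (simp add: L'_def U'_def)
    have Lg1: "L (k, i) \<noteq> g 1" if "(k, i) \<in> U'" for k i
    proof
      assume eq: "L (k, i) = g 1"
      have "1 \<le> k" using hall' that by (auto simp: hall_def)
      then have "L (k, i) \<in> {r. k \<le> thread_length (threads U') r}"
        using bij[of k] that by (auto simp: bij_betw_def mem_column)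
      then show False using g1[of k] eq \<open>1 \<le> k\<close> by simp
    qed
    have U_iff: "x \<in> U \<longleftrightarrow> x \<in> U' \<or> (\<exists>k\<in>{1..c}. x = (k, g k))" for x
      using g(1,5) by (auto simp: U'_def mem_column)
    have "bij_betw (\<lambda>i. L' (k, i)) (column U k) {r. k \<le> thread_length (threads U) r}" if "1 \<le> k" for k
    proof -
      have b: "bij_betw (\<lambda>i. L' (k, i)) (column U' k) {r. k \<le> thread_length (threads U') r}"
        using bij[OF that] bij_betw_cong[of "column U' k" "\<lambda>i. L (k, i)" "\<lambda>i. L' (k, i)"] L'U
        by (simp add: mem_column)
      show ?thesis
      proof (cases "k \<in> {1..c}")
        case True
        then have "bij_betw (\<lambda>i. L' (k, i)) (insert (g k) (column U' k))
            (insert (L' (k, g k)) {r. k \<le> thread_length (threads U') r})"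
          using b gU'[OF True] L't[OF True] g1[of k] by (subst notIn_Un_bij_betw3[symmetric, simplified])  (auto simp: mem_column)
        then show ?thesis using True that L't[OF True] by (simp add: col tl)
      next
        case False
        then show ?thesis using b that by (simp only: col tl if_False)
      qed
    qed
    moreover have "\<forall>(k, i) \<in> U. i \<le> L' (k, i)"
    proof (safe)
      fix k i assume "(k, i) \<in> U"
      then consider "(k, i) \<in> U'" | "k \<in> {1..c}" "i = g k" using U_iff by auto
      then show "i \<le> L' (k, i)"
        by cases (use ge L'U L't g_anti[of 1 k] in auto)
    qed
    moreover have "\<forall>(k, i) \<in> U. \<forall>(k', i') \<in> U. k < k' \<and> L' (k, i) = L' (k', i') \<longrightarrow> i' \<le> i"
    proof (safe)
      fix k i k' i' assume kU: "(k, i) \<in> U" "(k', i') \<in> U" "k < k'" and eq: "L' (k, i) = L' (k', i')"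
      show "i' \<le> i"
      proof (cases "(k, i) \<in> U'")
        case True
        then have "L' (k', i') \<noteq> g 1" using eq L'U Lg1 by metis
        then have k': "(k', i') \<in> U'" using kU U_iff L't by auto
        then have "L (k, i) = L (k', i')" using eq L'U True by simp
        then show ?thesis using desc True k' kU(3) by blast
      next
        case False
        then have k: "k \<in> {1..c}" "i = g k" using kU U_iff by auto
        then have "(k', i') \<notin> U'" using eq L't L'U Lg1 by metis
        then have "k' \<in> {1..c}" "i' = g k'" using kU U_iff by auto
        then show ?thesis using k kU g_anti by auto
      qed
    qed
    moreover have "\<forall>i\<in>column U 1. L' (1, i) = i"
      using g(4) L't[of 1] L'U pin by (auto simp: col mem_column)
    ultimately show ?thesis by blast
  qed
qed

lemma threads_support:
  assumes "hall U"
  shows "{r. 1 \<le> thread_length (threads U) r} = column U 1"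
proof -
  obtain L where "bij_betw (\<lambda>i. L (1::nat, i)) (column U 1) {r. 1 \<le> thread_length (threads U) r}"
    and pin: "\<forall>i\<in>column U 1. L (1, i) = i"
    using threads_labeling[OF assms] by blast
  then have "bij_betw (\<lambda>i. i) (column U 1) {r. 1 \<le> thread_length (threads U) r}"
    using bij_betw_cong[of "column U 1" "\<lambda>i. L (1, i)" "\<lambda>i. i"] by simp
  then show ?thesis by (simp add: bij_betw_def)
qed

text \<open>Threads are greedy: their ends are dominated by the ends of any other way of continuing a
  column to column 1 by dominating subsets of the columns.\<close>

lemma threads_minimal:
  assumes "hall U" "1 \<le> n" "\<And>k. 1 \<le> k \<Longrightarrow> k \<le> n \<Longrightarrow> S k \<subseteq> column U k" "S n = column U n"
    and "\<And>k. 1 \<le> k \<Longrightarrow> k < n \<Longrightarrow> dom_le (S (Suc k)) (S k)"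
  shows "dom_le {r. n \<le> thread_length (threads U) r} (S 1)"
  using assms
proof (induction U arbitrary: S rule: threads.induct)
  case (1 U)
  note sub = "1.prems"(3) and Sn = "1.prems"(4) and dom = "1.prems"(5)
  show ?case
  proof (cases "U = {}")
    case True
    then show ?thesis using \<open>1 \<le> n\<close> by (simp add: dom_le_def above_def)
  next
    case False
    define c where "c = Max (fst ` U)"
    define t where "t = thread U c (Min (column U c))"
    define U' where "U' = U - set t"
    have fin: "finite U" using 1 by (simp add: hall_def)
    obtain g where g: "set t = (\<lambda>k. (k, g k)) ` {1..c}" "length t = c" "last t = (1, g 1)" "1 \<le> c"
      "\<forall>k\<in>{1..c}. g k \<in> column U k"
      "\<forall>k. 1 \<le> k \<and> k < c \<longrightarrow> g (Suc k) \<le> g k \<and> (\<forall>x\<in>column U k. g (Suc k) \<le> x \<longrightarrow> g k \<le> x)"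
      and empty: "\<forall>k>c. column U k = {}"
      and hall': "hall U'"
      using first_thread[OF 1(2) False c_def t_def] U'_def by blast
    have thr: "threads U = t # threads U'"
      using fin False by (simp add: threads.simps[of U] Let_def c_def t_def U'_def)
    show ?thesis
    proof (cases "n \<le> c")
      case False
      obtain L where "bij_betw (\<lambda>i. L (n, i)) (column U n) {r. n \<le> thread_length (threads U) r}"
        using threads_labeling[OF \<open>hall U\<close>] \<open>1 \<le> n\<close> by blast
      then have "{r. n \<le> thread_length (threads U) r} = {}"
        using empty False by (simp add: bij_betw_def)
      then show ?thesis by (simp only: dom_le_def above_def) simp
    next
      case True
      have finS: "finite (S k)" if "1 \<le> k" "k \<le> n" for k
        using sub[OF that] finite_column[OF fin] by (rule finite_subset)
      \<comment> \<open>Downward induction from \<open>n\<close>: domination gives an element of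
        \<open>S k\<close> weakly above \<open>g (Suc k)\<close>, and greediness puts it weakly
        above \<open>g k\<close>.\<close>
      have ex: "1 \<le> k \<Longrightarrow> \<exists>x. x \<in> S k \<and> g k \<le> x" if "k \<le> n" for k
        using that
      proof (induction k rule: inc_induct)
        case base
        then show ?case using Sn g(5) True by auto
      next
        case (step k)
        then obtain x where x: "x \<in> S (Suc k)" "g (Suc k) \<le> x" by auto
        then obtain y where "y \<in> S k" "g (Suc k) \<le> y"
          using dom_leD_ex[of "S (Suc k)" "S k" x "g (Suc k)"] finS dom step by auto
        moreover from this have "g k \<le> y" using g(6) sub[of k] step True by auto
        ultimately show ?case by blast
      qed
      \<comment> \<open>As the thread leaves the columns, \<open>e k\<close> leaves
        \<open>S k\<close>. For \<open>k < n\<close> it is also the least element of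
        \<open>S k\<close> weakly above \<open>g (Suc k)\<close>, so domination survives. In column
        \<open>n\<close> it equals \<open>g n\<close>; in column 1 it is weakly above the lost end
        \<open>g 1\<close>.\<close>
      define e where "e = (\<lambda>k. LEAST x. x \<in> S k \<and> g k \<le> x)"
      have e: "e k \<in> S k" "g k \<le> e k" if "1 \<le> k" "k \<le> n" for k
        using LeastI_ex[OF ex[OF that(2,1)]] by (auto simp: e_def)
      have e_le: "e k \<le> x" if "x \<in> S k" "g k \<le> x" for k x
        unfolding e_def using that by (intro Least_le) auto
      have col: "column U' k = column U k - {g k}" if "1 \<le> k" "k \<le> n" for k
        using that True g(1) by (auto simp: column_def U'_def)
      have "dom_le {r. n \<le> thread_length (threads U') r} (S 1 - {e 1})"
      proof (rule 1(1)[of c t "\<lambda>k. S k - {e k}", folded U'_def])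
        show "finite U \<and> U \<noteq> {}" using fin False \<open>U \<noteq> {}\<close> by simp
        show "S k - {e k} \<subseteq> column U' k" if "1 \<le> k" "k \<le> n" for k
          using sub[OF that] e[OF that] e_le[of "g k" k] by (auto simp: col[OF that])
        show "S n - {e n} = column U' n"
        proof -
          have "g n \<in> S n" using g(5) Sn \<open>1 \<le> n\<close> True by simp
          then have "e n = g n" using e[of n] e_le[of "g n" n] \<open>1 \<le> n\<close> by simp
          then show ?thesis using col[of n] Sn \<open>1 \<le> n\<close> by simp
        qed
        show "dom_le (S (Suc k) - {e (Suc k)}) (S k - {e k})" if "1 \<le> k" "k < n" for k
        proof (rule dom_le_remove_least[of _ _ _ "g (Suc k)"])
          have k: "g (Suc k) \<le> g k" "\<forall>x\<in>column U k. g (Suc k) \<le> x \<longrightarrow> g k \<le> x"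
            using g(6) that True by auto
          show "g (Suc k) \<le> e k" using k e[of k] that by simp
          show "e k \<le> x" if "x \<in> S k" "g (Suc k) \<le> x" for x
            using that k(2) e_le[of x k] sub[of k] \<open>1 \<le> k\<close> \<open>k < n\<close> by auto
        qed (use that finS dom e e_le in auto)
      qed (rule c_def t_def hall' \<open>1 \<le> n\<close>)+
      moreover have "g 1 \<notin> {r. n \<le> thread_length (threads U') r}"
      proof
        assume "g 1 \<in> {r. n \<le> thread_length (threads U') r}"
        then have "g 1 \<in> {r. 1 \<le> thread_length (threads U') r}" using \<open>1 \<le> n\<close> by simp
        then have "g 1 \<in> column U' 1" unfolding threads_support[OF hall'] .
        then show False using col[of 1] \<open>1 \<le> n\<close> by simp
      qed
      moreover have "{r. n \<le> thread_length (threads U) r} = insert (g 1) {r. n \<le> thread_length (threads U') r}"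
        using g(2,3) True by (auto simp: thr thread_length_Cons)
      moreover have "finite {r. n \<le> thread_length (threads U') r}"
      proof (rule finite_subset)
        show "{r. n \<le> thread_length (threads U') r} \<subseteq> {r. 1 \<le> thread_length (threads U') r}"
          using \<open>1 \<le> n\<close> by auto
        show "finite {r. 1 \<le> thread_length (threads U') r}"
          unfolding threads_support[OF hall'] using hall' by (simp add: hall_def)
      qed
      ultimately show ?thesis
        using e[of 1] \<open>1 \<le> n\<close> finS[of 1] above_remove[of "S 1" "e 1"]
        unfolding dom_le_def by (simp add: above_insert le_SucI)
    qed
  qed
qed


section \<open>Kohnert diagrams\<close>

definition labels_ge :: "composition \<Rightarrow> nat \<Rightarrow> nat set" where
  "labels_ge \<alpha> c = {r. 1 \<le> r \<and> r \<le> length \<alpha> \<and> c \<le> part \<alpha> r}"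

text \<open>The cells of column \<open>c\<close> are matched weakly upward into selected cells of
  the columns to the left, one column at a time. \<open>S 0\<close> lies outside the diagram; it is
  the place for labels.\<close>

definition dominated_chain :: "diagram \<Rightarrow> nat \<Rightarrow> (nat \<Rightarrow> nat set) \<Rightarrow> bool" where
  "dominated_chain T c S \<longleftrightarrow> (\<forall>k. 1 \<le> k \<and> k \<le> c \<longrightarrow> S k \<subseteq> column T k) \<and> S c = column T c \<and>
     (\<forall>k<c. dom_le (S (Suc k)) (S k))"

text \<open>The chains for different \<open>c\<close> need not be compatible, so a Kohnert move can
  be followed in each of them separately.\<close>

definition kohnert_inv :: "composition \<Rightarrow> diagram \<Rightarrow> bool" where
  "kohnert_inv \<beta> T \<longleftrightarrow> T \<subseteq> {1..} \<times> {1..length \<beta>} \<and> finite T \<and>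
     (\<forall>c\<ge>1. card (column T c) = card (labels_ge \<beta> c) \<and>
        (\<exists>S. S 0 = labels_ge \<beta> c \<and> dominated_chain T c S))"

lemma finite_labels_ge [simp]: "finite (labels_ge \<alpha> c)"
  by (rule finite_subset[of _ "{..length \<alpha>}"]) (auto simp: labels_ge_def)

lemma finite_comp_diagram: "finite (comp_diagram \<alpha>)"
proof (rule finite_subset)
  show "comp_diagram \<alpha> \<subseteq> {..Max (insert 0 (set \<alpha>))} \<times> {..length \<alpha>}"
  proof
    fix x assume x: "x \<in> comp_diagram \<alpha>"
    obtain c i where ci: "x = (c, i)" by (cases x)
    then have i: "1 \<le> i" "i \<le> length \<alpha>" "c \<le> \<alpha> ! (i - 1)"
      using x by (auto simp: comp_diagram_def part_def)
    moreover have "\<alpha> ! (i - 1) \<le> Max (insert 0 (set \<alpha>))"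
      using i by (intro Max_ge) auto
    ultimately have "c \<le> Max (insert 0 (set \<alpha>))" by (blast intro: le_trans)
    then show "x \<in> {..Max (insert 0 (set \<alpha>))} \<times> {..length \<alpha>}"
      using ci i by simp
  qed
qed simp

lemma kohnert_inv_comp_diagram: "kohnert_inv \<beta> (comp_diagram \<beta>)"
proof -
  have col: "column (comp_diagram \<beta>) c = labels_ge \<beta> c" if "1 \<le> c" for c
    using that by (auto simp: column_def comp_diagram_def labels_ge_def)
  have "\<exists>S. S 0 = labels_ge \<beta> c \<and> dominated_chain (comp_diagram \<beta>) c S" if "1 \<le> c" for c
  proof (intro exI conjI)
    have "labels_ge \<beta> c \<subseteq> labels_ge \<beta> k" if "k \<le> c" for k
      using that by (auto simp: labels_ge_def)
    then show "dominated_chain (comp_diagram \<beta>) c (\<lambda>_. labels_ge \<beta> c)"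
      using that by (simp add: dominated_chain_def col)
  qed (rule refl)
  moreover have "comp_diagram \<beta> \<subseteq> {1..} \<times> {1..length \<beta>}" by (auto simp: comp_diagram_def)
  ultimately show ?thesis
    using finite_comp_diagram[of \<beta>] unfolding kohnert_inv_def by (simp add: col)
qed

text \<open>If \<open>S c\<close> loses the moved cell, the highest position below it outside \<open>S c\<close> is used instead.\<close>

lemma dominated_chain_kohnert_move:
  assumes T: "finite T" and S: "dominated_chain T n S" and n: "1 \<le> n" and c: "1 \<le> c"
    and i: "(c, i) \<in> T" "\<forall>c'>c. (c', i) \<notin> T"
    and j: "j < i" "(c, j) \<notin> T" "\<forall>l. j < l \<and> l < i \<longrightarrow> (c, l) \<in> T"
  shows "\<exists>S'. S' 0 = S 0 \<and> dominated_chain (insert (c, j) (T - {(c, i)})) n S'"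
proof -
  let ?T' = "insert (c, j) (T - {(c, i)})"
  have sub: "S k \<subseteq> column T k" if "1 \<le> k" "k \<le> n" for k
    using S that by (auto simp: dominated_chain_def)
  have dom: "above (S (Suc k)) z \<le> above (S k) z" if "k < n" for k z
    using S that by (auto simp: dominated_chain_def dom_le_def)
  have col: "column ?T' k = (if k = c then insert j (column T c - {i}) else column T k)" for k
    using j(1) by (auto simp: column_def)
  show ?thesis
  proof (cases "c \<le> n \<and> i \<in> S c")
    case False
    have "S k \<subseteq> column ?T' k" if "1 \<le> k" "k \<le> n" for k
      using sub[OF that] False that by (auto simp: col)
    moreover have "c \<noteq> n" using False i S by (auto simp: dominated_chain_def mem_column)
    ultimately show ?thesis using S by (intro exI[of _ S]) (auto simp: dominated_chain_def col)
  next
    case True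
    have finS: "finite (S c)" using sub[of c] c True finite_column[OF T] by (blast intro: finite_subset)
    have jS: "j \<notin> S c" using sub[of c] c True j(2) by (auto simp: mem_column)
    define l where "l = Max {x. x < i \<and> x \<notin> S c}"
    have "l \<in> {x. x < i \<and> x \<notin> S c}" unfolding l_def using j(1) jS by (intro Max_in) auto
    then have l: "l < i" "l \<notin> S c" by auto
    have l_max: "x \<in> S c" if "l < x" "x < i" for x
    proof (rule ccontr)
      assume "x \<notin> S c"
      then have "x \<le> l" unfolding l_def using that by (intro Max_ge) auto
      then show False using that by simp
    qed
    have "j \<le> l" unfolding l_def using j(1) jS by (intro Max_ge) auto
    define S' where "S' = S(c := insert l (S c - {i}))"
    have above': "above (S' c) z + (if z \<le> i then 1 else 0) = above (S c) z + (if z \<le> l then 1 else 0)" for z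
      using above_remove[of "S c" i z] above_insert[of "S c - {i}" l z] finS l True
      by (simp add: S'_def)
    \<comment> \<open>All positions strictly between \<open>j\<close> and \<open>i\<close> are
      occupied, so the substitute for \<open>i\<close> is a cell of the new diagram in either
      case.\<close>
    have "l = j \<or> l \<in> column T c" using j(3) l(1) \<open>j \<le> l\<close> by (simp add: mem_column le_less) blast
    then have "S' k \<subseteq> column ?T' k" if "1 \<le> k" "k \<le> n" for k
      using sub[OF that] l(1) by (auto simp: S'_def col)
    moreover have "S' n = column ?T' n"
    proof (cases "c = n")
      case True
      then have "S c = column T c" using S by (simp add: dominated_chain_def)
      moreover from this have "l = j" using l(2) \<open>l = j \<or> l \<in> column T c\<close> by blast
      ultimately show ?thesis unfolding S'_def col using True by simp
    qed (use S in \<open>auto simp: dominated_chain_def S'_def col\<close>)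
    moreover have "above (S' (Suc k)) z \<le> above (S' k) z" if k: "k < n" for k z
    proof -
      consider "Suc k = c" | "k = c" "z \<le> l \<or> i < z" | "k = c" "l < z" "z \<le> i" | "k \<noteq> c" "Suc k \<noteq> c"
        by linarith
      then show ?thesis
      proof cases
        case 1
        then show ?thesis using above'[of z] dom[OF k, of z] l by (auto simp: S'_def split: if_splits)
      next
        case 2
        then show ?thesis using above'[of z] dom[OF k, of z] l by (auto simp: S'_def split: if_splits)
      next
        case 3
        \<comment> \<open>The moved cell was rightmost in its row, so \<open>S (Suc c)\<close>
          misses \<open>i\<close>, while \<open>S c\<close> contains everything from
          \<open>z\<close> to \<open>i\<close> by the choice of \<open>l\<close>. With the old
          domination above \<open>i\<close>, this leaves the one unit that is lost at
          \<open>z\<close>.\<close>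
        have "i \<notin> S (Suc c)" using sub[of "Suc c"] k 3 i by (auto simp: mem_column)
        have sub': "{x \<in> S (Suc c). z \<le> x} \<subseteq> {z..<i} \<union> {x \<in> S (Suc c). Suc i \<le> x}"
        proof
          fix x assume x: "x \<in> {x \<in> S (Suc c). z \<le> x}"
          then have "x \<noteq> i" using \<open>i \<notin> S (Suc c)\<close> by blast
          then have "x < i \<or> Suc i \<le> x" by linarith
          then show "x \<in> {z..<i} \<union> {x \<in> S (Suc c). Suc i \<le> x}" using x by auto
        qed
        have "finite (S (Suc c))"
          using sub[of "Suc c"] k 3 finite_column[OF T] by (auto intro: finite_subset)
        then have "above (S (Suc c)) z \<le> (i - z) + above (S (Suc c)) (Suc i)"
          unfolding above_def
          using card_mono[OF _ sub'] card_Un_le[of "{z..<i}" "{x \<in> S (Suc c). Suc i \<le> x}"] by fastforce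
        also have "\<dots> \<le> (i - z) + above (S c) (Suc i)" using dom[OF k, of "Suc i"] 3 by simp
        also have "\<dots> < above (S c) z"
        proof -
          have "x \<in> S c" if "z \<le> x" "x \<le> i" for x
            using l_max[of x] that 3 True by (cases "x = i") auto
          then have "{x \<in> S c. z \<le> x} = {z..i} \<union> {x \<in> S c. Suc i \<le> x}"
            using 3 by (auto simp: not_less_eq_eq)
          moreover have "card ({z..i} \<union> {x \<in> S c. Suc i \<le> x}) = Suc (i - z) + above (S c) (Suc i)"
            unfolding above_def using finS 3 by (subst card_Un_disjoint) auto
          ultimately show ?thesis by (simp add: above_def)
        qed
        finally show ?thesis using above'[of z] 3 by (simp add: S'_def)
      next
        case 4
        then show ?thesis using dom[OF k] by (simp add: S'_def)
      qed
    qed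
    ultimately have "dominated_chain ?T' n S'" by (auto simp: dominated_chain_def dom_le_def)
    moreover have "S' 0 = S 0" using c by (simp add: S'_def)
    ultimately show ?thesis by blast
  qed
qed

lemma kohnert_inv_move:
  assumes "kohnert_inv \<beta> T" "kohnert_move T T'"
  shows "kohnert_inv \<beta> T'"
proof -
  obtain c i j where i: "(c, i) \<in> T" "\<forall>c'>c. (c', i) \<notin> T"
    and j: "1 \<le> j" "j < i" "(c, j) \<notin> T" "\<forall>l. j < l \<and> l < i \<longrightarrow> (c, l) \<in> T"
    and T': "T' = insert (c, j) (T - {(c, i)})"
    using assms(2) unfolding kohnert_move_def by blast
  have T: "T \<subseteq> {1..} \<times> {1..length \<beta>}" "finite T" using assms(1) by (auto simp: kohnert_inv_def)
  have ci: "1 \<le> c" "i \<le> length \<beta>" using T i by auto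
  have col: "column T' k = (if k = c then insert j (column T c - {i}) else column T k)" for k
    using j(2) by (auto simp: column_def T')
  have card: "card (column T' k) = card (column T k)" for k
  proof -
    have "i \<in> column T c" "j \<notin> column T c" using i(1) j(3) by (auto simp: mem_column)
    then show ?thesis
      using T(2) card.remove[of "column T c" i] unfolding col by simp
  qed
  have "T' \<subseteq> {1..} \<times> {1..length \<beta>}" using T ci j(1,2) by (auto simp: T')
  then show ?thesis
    unfolding kohnert_inv_def
  proof (intro conjI allI impI)
    show "finite T'" using T by (simp add: T')
    fix n :: nat assume n: "1 \<le> n"
    then show "card (column T' n) = card (labels_ge \<beta> n)"
      using card assms(1) by (simp add: kohnert_inv_def)
    obtain S where S: "S 0 = labels_ge \<beta> n" "dominated_chain T n S"
      using assms(1) n unfolding kohnert_inv_def by blast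
    obtain S' where "S' 0 = S 0" "dominated_chain T' n S'"
      using dominated_chain_kohnert_move[OF T(2) S(2) n ci(1) i j(2-4)] unfolding T' by blast
    then show "\<exists>S. S 0 = labels_ge \<beta> n \<and> dominated_chain T' n S" using S(1) by auto
  qed
qed

lemma KD_kohnert_inv: "T \<in> KD \<beta> \<Longrightarrow> kohnert_inv \<beta> T"
  unfolding KD_def mem_Collect_eq
  by (induction rule: rtranclp_induct) (auto intro: kohnert_inv_comp_diagram kohnert_inv_move)

lemma hall_if_kohnert_inv:
  assumes "kohnert_inv \<beta> T"
  shows "hall T"
  unfolding hall_def
proof (intro conjI allI impI)
  show "finite T" "\<forall>(c, i) \<in> T. 1 \<le> c" using assms by (auto simp: kohnert_inv_def)
  fix c :: nat assume c: "1 \<le> c"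
  then obtain S where S: "dominated_chain T (Suc c) S"
    using assms unfolding kohnert_inv_def by (metis le_Suc_eq)
  then have "S (Suc c) = column T (Suc c)" "S c \<subseteq> column T c" "dom_le (S (Suc c)) (S c)"
    using c by (auto simp: dominated_chain_def)
  then show "dom_le (column T (Suc c)) (column T c)"
    using above_mono[OF finite_column[OF \<open>finite T\<close>]] unfolding dom_le_def by (metis le_trans)
qed

section \<open>Level sets of the thread composition, and the insertion shape\<close>

lemma labels_ge_eq_parts_ge: "labels_ge \<alpha> c = Suc ` parts_ge \<alpha> c"
proof (intro equalityI subsetI)
  fix r assume r: "r \<in> labels_ge \<alpha> c"
  then have "r = Suc (r - 1)" "r - 1 \<in> parts_ge \<alpha> c"
    by (auto simp: labels_ge_def parts_ge_def part_def)
  then show "r \<in> Suc ` parts_ge \<alpha> c" by blast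
qed (auto simp: labels_ge_def parts_ge_def part_def)

lemma above_image_Suc: "above (Suc ` X) (Suc z) = above X z"
proof -
  have "{x \<in> Suc ` X. Suc z \<le> x} = Suc ` {x \<in> X. z \<le> x}" by auto
  then show ?thesis by (simp add: above_def card_image)
qed

lemma length_theta [simp]: "length (theta m T) = m"
  by (simp add: theta_def)

lemma nth_theta: "i < m \<Longrightarrow> theta m T ! i = thread_length (threads T) (Suc i)"
  by (simp add: theta_def thread_length_def del: upt_Suc)

lemma part_theta: "1 \<le> r \<Longrightarrow> r \<le> m \<Longrightarrow> part (theta m T) r = thread_length (threads T) r"
  by (simp add: part_def nth_theta)

lemma labels_ge_theta:
  assumes "kohnert_inv \<beta> T" "1 \<le> c"
  shows "labels_ge (theta (length \<beta>) T) c = {r. c \<le> thread_length (threads T) r}"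
proof -
  have "1 \<le> r \<and> r \<le> length \<beta>" if "c \<le> thread_length (threads T) r" for r
  proof -
    have "r \<in> {r. 1 \<le> thread_length (threads T) r}" using that assms(2) by simp
    then have "r \<in> column T 1" unfolding threads_support[OF hall_if_kohnert_inv[OF assms(1)]] .
    then show ?thesis using assms(1) by (auto simp: kohnert_inv_def mem_column)
  qed
  then show ?thesis by (auto simp: labels_ge_def part_theta)
qed

lemma theta_semi_proper:
  assumes "kohnert_inv \<beta> T"
  shows "\<exists>L. semi_proper (theta (length \<beta>) T) T L"
proof -
  obtain L where L: "\<forall>c\<ge>1. bij_betw (\<lambda>i. L (c, i)) (column T c) {r. c \<le> thread_length (threads T) r}"
    "\<forall>(c, i) \<in> T. i \<le> L (c, i)"
    "\<forall>(c, i) \<in> T. \<forall>(c', i') \<in> T. c < c' \<and> L (c, i) = L (c', i') \<longrightarrow> i' \<le> i"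
    using threads_labeling[OF hall_if_kohnert_inv[OF assms]] by blast
  have "bij_betw (\<lambda>i. L (c, i)) (column T c) (labels_ge (theta (length \<beta>) T) c)" if "1 \<le> c" for c
    unfolding labels_ge_theta[OF assms that] using L(1) that by blast
  then show ?thesis using L(2,3) unfolding semi_proper_def labels_ge_def by blast
qed

lemma theta_support:
  assumes "kohnert_inv \<beta> T"
  shows "labels_ge (theta (length \<beta>) T) 1 = column T 1"
  unfolding labels_ge_theta[OF assms order_refl]
  by (rule threads_support[OF hall_if_kohnert_inv[OF assms]])

text \<open>At level \<open>c\<close> the ends of the threads through column \<open>c\<close> are
  dominated by \<open>S 1\<close>, for the chain \<open>S\<close> of column \<open>c\<close>, and
  \<open>S 1\<close> is dominated by the labels in \<open>S 0\<close>.\<close>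

lemma theta_swap_le:
  assumes inv: "kohnert_inv \<beta> T"
  shows "theta (length \<beta>) T \<preceq> \<beta>"
proof (rule swap_le_if_dom_le)
  let ?\<theta> = "theta (length \<beta>) T"
  show "length ?\<theta> = length \<beta>" by simp
  have zero: "parts_ge ?\<theta> 0 = parts_ge \<beta> 0" by (auto simp: parts_ge_def)
  note hall = hall_if_kohnert_inv[OF inv]
  show "card (parts_ge ?\<theta> c) = card (parts_ge \<beta> c)" for c
  proof (cases "c = 0")
    case True
    then show ?thesis using zero by simp
  next
    case False
    then have c: "1 \<le> c" by simp
    obtain L where "\<forall>c\<ge>1. bij_betw (\<lambda>i. L (c, i)) (column T c) {r. c \<le> thread_length (threads T) r}"
      using threads_labeling[OF hall] by blast
    then have "bij_betw (\<lambda>i. L (c, i)) (column T c) (labels_ge ?\<theta> c)"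
      unfolding labels_ge_theta[OF inv c] using c by blast
    then have "card (labels_ge ?\<theta> c) = card (labels_ge \<beta> c)"
      using bij_betw_same_card inv c unfolding kohnert_inv_def by metis
    then show ?thesis by (simp add: labels_ge_eq_parts_ge card_image)
  qed
  show "dom_le (parts_ge ?\<theta> c) (parts_ge \<beta> c)" for c
  proof (cases "c = 0")
    case True
    then show ?thesis using zero by simp
  next
    case False
    then have c: "1 \<le> c" by simp
    then obtain S where S: "S 0 = labels_ge \<beta> c" "dominated_chain T c S"
      using inv unfolding kohnert_inv_def by blast
    have "dom_le (labels_ge ?\<theta> c) (S 1)"
      unfolding labels_ge_theta[OF inv c]
      using S(2) c by (intro threads_minimal[OF hall, of c S]) (auto simp: dominated_chain_def)
    moreover have "dom_le (S 1) (labels_ge \<beta> c)"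
      using S False by (auto simp: dominated_chain_def)
    ultimately have "dom_le (labels_ge ?\<theta> c) (labels_ge \<beta> c)" by (rule dom_le_trans)
    then show ?thesis
      unfolding labels_ge_eq_parts_ge dom_le_def using above_image_Suc by metis
  qed
qed

text \<open>\<open>SOME\<close> says something only if a maximal candidate exists. The composition
  \<open>theta\<close> is a candidate and \<open>weight\<close> is bounded by that of \<beta>, so a
  candidate of greatest weight is maximal.\<close>

lemma insertion_shape_ge_theta:
  assumes "kohnert_inv \<beta> T"
  shows "theta (length \<beta>) T \<preceq>\<^sup>0 insertion_shape \<beta> T"
proof -
  let ?\<theta> = "theta (length \<beta>) T"
  let ?P = "\<lambda>\<alpha>. ?\<theta> \<preceq>\<^sup>0 \<alpha> \<and> \<alpha> \<preceq> \<beta>"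
  have "?P ?\<theta>" using theta_swap_le[OF assms] by (simp add: pinned_swap_le_def)
  moreover have "\<forall>\<alpha>. ?P \<alpha> \<longrightarrow> weight \<alpha> < Suc (weight \<beta>)"
    using swap_le_weight by (metis less_Suc_eq)
  ultimately obtain \<alpha> where \<alpha>: "?P \<alpha>" "\<And>\<alpha>'. ?P \<alpha>' \<Longrightarrow> weight \<alpha>' \<le> weight \<alpha>"
    using ex_has_greatest_nat[of ?P ?\<theta> weight] by (metis less_imp_le_nat)
  have "\<exists>\<alpha>. ?\<theta> \<preceq>\<^sup>0 \<alpha> \<and> \<alpha> \<preceq> \<beta> \<and> (\<forall>\<alpha>'. ?\<theta> \<preceq>\<^sup>0 \<alpha>' \<and> \<alpha>' \<preceq> \<beta> \<and> \<alpha> \<preceq> \<alpha>' \<longrightarrow> \<alpha>' = \<alpha>)"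
    using \<alpha> swap_le_weight by (metis not_le)
  from someI_ex[OF this] show ?thesis unfolding insertion_shape_def by blast
qed

text \<open>A pinned swap exchanges two positive parts, so zeros stay in place. Column 1 of the
  diagram thus fixes the zeros of every admissible shape.\<close>

lemma pinned_swap_le_support:
  assumes "\<alpha> \<preceq>\<^sup>0 \<beta>"
  shows "length \<alpha> = length \<beta> \<and> labels_ge \<alpha> 1 = labels_ge \<beta> 1"
  using assms unfolding pinned_swap_le_def
proof (induction rule: rtranclp_induct)
  case (step \<gamma> \<delta>)
  then have "length \<delta> = length \<gamma> \<and> parts_ge \<delta> 1 = parts_ge \<gamma> 1"
    by (auto simp: pinned_left_swap_def parts_ge_def nth_list_update split: if_splits)
  then show ?case using step by (simp add: labels_ge_eq_parts_ge)
qed simp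


section \<open>Row insertion in terms of columns\<close>

lemma nth_rev_sorted_list_of_set:
  fixes S :: "nat set"
  assumes "finite S" "p < card S"
  shows "rev (sorted_list_of_set S) ! p \<in> S"
    and "above S (rev (sorted_list_of_set S) ! p) = Suc p"
proof -
  let ?xs = "sorted_list_of_set S"
  define q where "q = card S - Suc p"
  have len: "length ?xs = card S" and set: "set ?xs = S" using assms by auto
  have q: "q < card S" "card S - q = Suc p" using assms by (auto simp: q_def)
  have nth: "rev ?xs ! p = ?xs ! q" using assms len by (simp add: rev_nth q_def)
  show "rev ?xs ! p \<in> S" unfolding nth using q len set nth_mem[of q ?xs] by simp
  have strict: "sorted_wrt (<) ?xs" by (rule strict_sorted_list_of_set)
  have "{x \<in> S. ?xs ! q \<le> x} = (!) ?xs ` {q..<card S}"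
  proof (intro equalityI subsetI)
    fix x assume x: "x \<in> {x \<in> S. ?xs ! q \<le> x}"
    then have "x \<in> set ?xs" using set by simp
    then obtain i where i: "i < card S" "x = ?xs ! i" unfolding in_set_conv_nth len by blast
    have "q \<le> i"
    proof (rule ccontr)
      assume "\<not> q \<le> i"
      then have "?xs ! i < ?xs ! q" using sorted_wrt_nth_less[OF strict, of i q] q len by simp
      then show False using x i by simp
    qed
    then show "x \<in> (!) ?xs ` {q..<card S}" using i by simp
  next
    fix x assume "x \<in> (!) ?xs ` {q..<card S}"
    then obtain i where i: "q \<le> i" "i < card S" "x = ?xs ! i" by auto
    then have "?xs ! q \<le> ?xs ! i"
      using sorted_wrt_nth_less[OF strict, of q i] len by (cases "q = i") auto
    then show "x \<in> {x \<in> S. ?xs ! q \<le> x}" using i set len nth_mem[of i ?xs] by auto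
  qed
  moreover have "inj_on ((!) ?xs) {q..<card S}"
    using len by (auto intro!: inj_on_nth)
  ultimately show "above S (rev ?xs ! p) = Suc p"
    unfolding nth above_def using q by (simp add: card_image)
qed

lemma above_less:
  assumes "finite S" "x \<in> S" "x < y"
  shows "above S y < above S x"
proof -
  have "above S y \<le> above S (Suc x)" using assms by (intro above_antimono) auto
  then show ?thesis using above_Suc[of S x] assms by simp
qed

lemma above_inj:
  assumes "finite S" "x \<in> S" "y \<in> S" "above S x = above S y"
  shows "x = y"
  using above_less[OF assms(1,2), of y] above_less[OF assms(1,3), of x] assms(4) by (cases x y rule: linorder_cases) auto

text \<open>\<open>above\<close> is the rank from the top of a column, starting with 1; lifting puts
  rank \<open>p + 1\<close> into row \<open>N - p\<close>.\<close>

lemma phi_eq_Some_iff: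
  assumes "finite (column U c)"
  shows "phi N U (c, i) = Some x \<longleftrightarrow>
    1 \<le> i \<and> i \<le> N \<and> x \<in> column U c \<and> above (column U c) x = Suc (N - i)"
proof -
  let ?S = "column U c"
  have len: "length (rev (sorted_list_of_set ?S)) = card ?S" by simp
  have "(N - i < card ?S \<and> rev (sorted_list_of_set ?S) ! (N - i) = x) \<longleftrightarrow>
      x \<in> ?S \<and> above ?S x = Suc (N - i)" (is "?l \<longleftrightarrow> ?r")
  proof
    assume ?r
    then have "N - i < card ?S" using above_antimono[OF assms, of 0 x] by simp
    moreover have "rev (sorted_list_of_set ?S) ! (N - i) = x"
    proof (rule above_inj[OF assms])
      show "rev (sorted_list_of_set ?S) ! (N - i) \<in> ?S"
        by (rule nth_rev_sorted_list_of_set(1)[OF assms \<open>N - i < card ?S\<close>])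
      show "x \<in> ?S" using \<open>?r\<close> by blast
      show "above ?S (rev (sorted_list_of_set ?S) ! (N - i)) = above ?S x"
        unfolding nth_rev_sorted_list_of_set(2)[OF assms \<open>N - i < card ?S\<close>] using \<open>?r\<close> by (elim conjE) (rule sym)
    qed
    ultimately show ?l by simp
  next
    assume ?l
    then show ?r using nth_rev_sorted_list_of_set[OF assms, of "N - i"] by blast
  qed
  moreover have "phi N U (c, i) = Some x \<longleftrightarrow> 1 \<le> i \<and> i \<le> N \<and> ?l"
    unfolding phi_def Let_def prod.case len by (simp split: if_split) blast
  ultimately show ?thesis by (simp only: conj_assoc)
qed

lemma phi_cong_column:
  assumes "column U c = column U' c"
  shows "phi N U (c, i) = phi N U' (c, i)"
  using assms by (simp add: phi_def)

text \<open>Serves both outcomes in a row: replacement, if a cell of rank \<open>p + 1\<close> is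
  lost, and appending, if none is lost.\<close>

lemma phi_update:
  assumes fin: "finite T" "finite T'"
    and other: "\<And>c. c \<noteq> d \<Longrightarrow> column T' c = column T c"
    and v: "v \<in> column T' d" "v \<notin> column T d" "above (column T' d) v = Suc p" "p < N"
    and sub: "column T' d \<subseteq> insert v (column T d)"
    and kept: "\<And>x. x \<in> column T' d \<Longrightarrow> x \<noteq> v \<Longrightarrow> above (column T' d) x = above (column T d) x"
    and lost: "\<And>y. y \<in> column T d \<Longrightarrow> y \<notin> column T' d \<Longrightarrow> above (column T d) y = Suc p"
  shows "phi N T' = (phi N T)((d, N - p) \<mapsto> v)"
proof
  fix x :: cell
  obtain c i where x: "x = (c, i)" by (cases x)
  note iff = phi_eq_Some_iff[OF finite_column[OF fin(1)]] phi_eq_Some_iff[OF finite_column[OF fin(2)]]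
  show "phi N T' x = ((phi N T)((d, N - p) \<mapsto> v)) x"
  proof (cases "c = d")
    case False
    then show ?thesis using phi_cong_column[OF other] x by simp
  next
    case True
    show ?thesis
    proof (cases "i = N - p")
      case True
      then have "phi N T' (d, i) = Some v" using v by (simp add: iff)
      then show ?thesis using True x \<open>c = d\<close> by simp
    next
      case False
      have "phi N T' (d, i) = Some e \<longleftrightarrow> phi N T (d, i) = Some e" for e
      proof -
        have "e \<in> column T' d \<and> above (column T' d) e = Suc (N - i) \<longleftrightarrow>
          e \<in> column T d \<and> above (column T d) e = Suc (N - i)" if "1 \<le> i" "i \<le> N"
        proof -
          have "p \<noteq> N - i" using False that by auto
          then show ?thesis using v(1-3) sub kept[of e] lost[of e]
            by (cases "e = v"; cases "e \<in> column T' d") auto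
        qed
        then show ?thesis by (auto simp: iff)
      qed
      then have "phi N T' (d, i) = phi N T (d, i)" by (metis not_Some_eq)
      then show ?thesis using False x \<open>c = d\<close> by simp
    qed
  qed
qed

section \<open>Bumping within a single column\<close>

lemma hall_above_mono:
  assumes "hall T" "1 \<le> c" "c \<le> c'"
  shows "above (column T c') z \<le> above (column T c) z"
  using assms(3)
proof (induction c' rule: dec_induct)
  case (step n)
  then have "above (column T (Suc n)) z \<le> above (column T n) z"
    using assms by (auto simp: hall_def dom_le_def)
  then show ?case using step by simp
qed simp

text \<open>Keeps the insertion out of row 0: the cells counted lie in rows \<open>v + 1\<close> to
  \<open>N\<close>.\<close>

lemma above_vacant_less:
  assumes "S \<subseteq> {1..N}" "v \<notin> S" "1 \<le> v" "v \<le> N"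
  shows "above S v < N"
proof -
  have "{x \<in> S. v \<le> x} \<subseteq> {Suc v..N}"
  proof
    fix x assume x: "x \<in> {x \<in> S. v \<le> x}"
    then have "x \<noteq> v" "x \<le> N" using assms(1,2) by auto
    then show "x \<in> {Suc v..N}" using x by simp
  qed
  then have "above S v \<le> card {Suc v..N}" unfolding above_def by (intro card_mono) auto
  then show ?thesis using assms by simp
qed

text \<open>Equivalently, for \<open>d > 1\<close>, column \<open>d - 1\<close> has an entry at
  least \<open>v\<close> in the row that \<open>v\<close> enters. Column 1 always qualifies, in
  accord with the convention for column 0 in \<open>abuts\<close>.\<close>

definition slack :: "diagram \<Rightarrow> nat \<Rightarrow> nat \<Rightarrow> bool" where
  "slack T d v \<longleftrightarrow> d = 1 \<or> above (column T d) v < above (column T (d - 1)) v"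

text \<open>The state of the row insertion when the value \<open>v\<close> has been bumped into the row in which it
  would be placed in column \<open>d\<close>.\<close>

definition insert_column :: "nat \<Rightarrow> diagram \<Rightarrow> nat \<Rightarrow> nat \<Rightarrow> filling" where
  "insert_column N T d v = insert_from_row (N - above (column T d) v) (phi N T) v"

text \<open>An entry \<open>e < v\<close> of this row in a column left of \<open>d\<close> would
  leave at most \<open>above (column T d) v\<close> cells weakly above \<open>v\<close> there,
  against \<open>slack\<close>.\<close>

lemma insert_column_left_of:
  assumes "hall T" "slack T d v" "phi N T (c, N - above (column T d) v) = Some e" "e < v"
    "above (column T d) v < N"
  shows "d \<le> c"
proof (rule ccontr)
  assume "\<not> d \<le> c"
  have fin: "finite T" using assms(1) by (simp add: hall_def)
  have e: "e \<in> column T c" "above (column T c) e = Suc (above (column T d) v)"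
    using assms(3,5) phi_eq_Some_iff[OF finite_column[OF fin]] by auto
  then have "1 \<le> c" using assms(1) by (auto simp: hall_def mem_column)
  then have "above (column T d) v < above (column T (d - 1)) v"
    using assms(2) \<open>\<not> d \<le> c\<close> by (auto simp: slack_def)
  also have "\<dots> \<le> above (column T c) v"
    using \<open>\<not> d \<le> c\<close> \<open>1 \<le> c\<close> by (intro hall_above_mono assms) auto
  finally show False using above_less[of "column T c" e v] e fin assms(4) by simp
qed

text \<open>The largest cell \<open>y\<close> below \<open>v\<close> has the rank that belongs to
  the row entered by \<open>v\<close>, so it is the entry bumped. In the new column \<open>y\<close>
  counts one more cell above it, hence it continues one row lower, in a state of the same
  form.\<close>

lemma insert_column_bump:
  assumes T: "hall T" "column T d \<subseteq> {1..N}" and slack: "slack T d v"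
    and v: "v \<notin> column T d" "1 \<le> v" "v \<le> N"
    and y: "y \<in> column T d" "y < v" "\<And>x. x \<in> column T d \<Longrightarrow> x < v \<Longrightarrow> x \<le> y"
  defines "T' \<equiv> insert (d, v) (T - {(d, y)})"
  shows "insert_column N T d v = insert_column N T' d y"
    and "\<And>z. above (column T' d) z + (if z \<le> y then 1 else 0) = above (column T d) z + (if z \<le> v then 1 else 0)"
proof -
  let ?B = "column T d" and ?B' = "column T' d"
  have fin: "finite T" "finite T'" using T by (auto simp: hall_def T'_def)
  have col: "column T' c = (if c = d then insert v (?B - {y}) else column T c)" for c
    using y v by (auto simp: T'_def column_def)
  show above': "above ?B' z + (if z \<le> y then 1 else 0) = above ?B z + (if z \<le> v then 1 else 0)" for z
    using above_remove[of ?B y z] above_insert[of "?B - {y}" v z] fin v y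
    unfolding col by simp
  define p where "p = above ?B v"
  have "p < N" unfolding p_def by (rule above_vacant_less[OF T(2) v])
  then obtain i where i: "N - p = Suc i" by (metis Suc_diff_Suc)
  have "above ?B (Suc y) = p"
    unfolding p_def
  proof (rule above_eq_gap)
    show "v \<le> x" if "x \<in> ?B" "Suc y \<le> x" for x
      using y(3)[OF that(1)] that(2) by (cases "x < v") auto
  qed (use y in simp)
  then have py: "above ?B y = Suc p" using above_Suc[of ?B y] fin y by simp
  then have py': "above ?B' y = Suc p" using above'[of y] y by simp
  have iff: "phi N T (c, N - p) = Some e \<longleftrightarrow> e \<in> column T c \<and> above (column T c) e = Suc p" for c e
    using phi_eq_Some_iff[OF finite_column[OF fin(1)], of N c "N - p"] \<open>p < N\<close> by auto
  have ex: "phi N T (d, N - p) = Some y" using py y by (simp add: iff)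
  have least: "(LEAST c. \<exists>e. phi N T (c, N - p) = Some e \<and> e < v) = d"
  proof (rule Least_equality)
    show "\<exists>e. phi N T (d, N - p) = Some e \<and> e < v" using ex y by blast
    show "d \<le> c" if "\<exists>e. phi N T (c, N - p) = Some e \<and> e < v" for c
      using that insert_column_left_of[OF T(1) slack] \<open>p < N\<close> p_def by blast
  qed
  have "phi N T' = (phi N T)((d, N - p) \<mapsto> v)"
  proof (rule phi_update[OF fin])
    show "above ?B' v = Suc p" using above'[of v] y p_def by simp
    show "above ?B' x = above ?B x" if x: "x \<in> ?B'" "x \<noteq> v" for x
      using above'[of x] x y(2) y(3)[of x] by (cases "x < v") (auto simp: col)
    show "above ?B x = Suc p" if "x \<in> ?B" "x \<notin> ?B'" for x using that py by (auto simp: col)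
  qed (use v \<open>p < N\<close> in \<open>auto simp: col\<close>)
  moreover have "insert_from_row (Suc i) (phi N T) v = insert_from_row i ((phi N T)((d, Suc i) \<mapsto> v)) y"
  proof -
    have "\<exists>c e. phi N T (c, Suc i) = Some e \<and> e < v" using ex y(2) unfolding i by blast
    then show ?thesis
      by (subst insert_from_row.simps(2), subst if_P) (simp_all add: Let_def least[unfolded i] ex[unfolded i])
  qed
  moreover have "N - Suc p = i" using i by simp
  ultimately show "insert_column N T d v = insert_column N T' d y"
    unfolding insert_column_def p_def[symmetric] py' i by metis
qed

text \<open>All of column \<open>d\<close> lies above \<open>v\<close>, so this row is empty in
  column \<open>d\<close> and, by \<open>hall\<close>, to its right. \<open>slack\<close> fills it
  in column \<open>d - 1\<close>, so \<open>d\<close> is the end of the row.\<close>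

lemma insert_column_end:
  assumes T: "hall T" "column T d \<subseteq> {1..N}" and d: "1 \<le> d" and slack: "slack T d v"
    and v: "v \<notin> column T d" "1 \<le> v" "v \<le> N"
    and none: "\<And>x. x \<in> column T d \<Longrightarrow> v < x"
  shows "insert_column N T d v = phi N (insert (d, v) T)"
proof -
  let ?T' = "insert (d, v) T"
  let ?B = "column T d" and ?B' = "column ?T' d"
  have fin: "finite T" "finite ?T'" using T by (auto simp: hall_def)
  have col: "column ?T' c = (if c = d then insert v ?B else column T c)" for c
    by (auto simp: column_def)
  have above': "above ?B' z = above ?B z + (if z \<le> v then 1 else 0)" for z
    using above_insert[of ?B v z] fin v unfolding col by simp
  define p where "p = above ?B v"
  have "p < N" unfolding p_def by (rule above_vacant_less[OF T(2) v])
  then obtain i where i: "N - p = Suc i" by (metis Suc_diff_Suc)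
  have "above ?B 0 = p" unfolding p_def using none by (intro above_eq_gap) (auto intro: less_imp_le)
  then have le_p: "above (column T c) e \<le> p" if "d \<le> c" for c e
    using hall_above_mono[OF T(1) d that, of e] above_antimono[of ?B 0 e] fin by simp
  have iff: "phi N T (c, N - p) = Some e \<longleftrightarrow> e \<in> column T c \<and> above (column T c) e = Suc p" for c e
    using phi_eq_Some_iff[OF finite_column[OF fin(1)], of N c "N - p"] \<open>p < N\<close> by auto
  have right: "phi N T (c, N - p) = None" if "d \<le> c" for c
  proof (cases "phi N T (c, N - p)")
    case (Some e)
    then have "above (column T c) e = Suc p" by (simp add: iff)
    then show ?thesis using le_p[OF that, of e] by simp
  qed
  have no_bump: "\<not> (\<exists>c e. phi N T (c, N - p) = Some e \<and> e < v)"
  proof (intro notI, elim exE conjE)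
    fix c e assume e: "phi N T (c, N - p) = Some e" "e < v"
    then have "d \<le> c" using insert_column_left_of[OF T(1) slack] \<open>p < N\<close> unfolding p_def by blast
    then show False using right e(1) by simp
  qed
  have least: "(LEAST c. 1 \<le> c \<and> (\<forall>c'\<ge>c. phi N T (c', N - p) = None)) = d"
  proof (rule Least_equality)
    show "1 \<le> d \<and> (\<forall>c'\<ge>d. phi N T (c', N - p) = None)" using d right by blast
    fix c assume c: "1 \<le> c \<and> (\<forall>c'\<ge>c. phi N T (c', N - p) = None)"
    show "d \<le> c"
    proof (rule ccontr)
      assume "\<not> d \<le> c"
      then have cd: "c \<le> d - 1" "d \<noteq> 1" using c by auto
      have "p < above (column T (d - 1)) v" using slack cd by (simp add: slack_def p_def)
      also have "\<dots> \<le> card (column T (d - 1))" using above_antimono[of "column T (d - 1)" 0 v] fin by simp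
      finally have "\<exists>x. phi N T (d - 1, N - p) = Some x"
        using nth_rev_sorted_list_of_set[OF finite_column[OF fin(1)]] iff by blast
      then show False using c cd by auto
    qed
  qed
  have "phi N ?T' = (phi N T)((d, N - p) \<mapsto> v)"
  proof (rule phi_update[OF fin])
    show "above ?B' v = Suc p" using above'[of v] p_def by simp
    show "above ?B' x = above ?B x" if x: "x \<in> ?B'" "x \<noteq> v" for x
      using above'[of x] x none[of x] by (auto simp: col)
  qed (use v \<open>p < N\<close> in \<open>auto simp: col\<close>)
  then show ?thesis
    unfolding insert_column_def p_def[symmetric] i insert_from_row.simps(2)
    using no_bump least unfolding i by (subst if_not_P) simp_all
qed

text \<open>Counts in column \<open>d\<close> rise, by one, only at thresholds above
  \<open>y\<close> up to \<open>v\<close>. There column \<open>d\<close> counted as many cells as at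
  \<open>v\<close>, where \<open>slack\<close> leaves room.\<close>

lemma hall_bump:
  assumes T: "hall T" and d: "1 \<le> d" and slack: "slack T d v" and v: "v \<notin> column T d"
    and y: "y \<in> column T d" "y < v" "\<And>x. x \<in> column T d \<Longrightarrow> x < v \<Longrightarrow> x \<le> y"
  shows "hall (insert (d, v) (T - {(d, y)}))" (is "hall ?T'")
  unfolding hall_def
proof (intro conjI allI impI)
  show "finite ?T'" "\<forall>(c, i) \<in> ?T'. 1 \<le> c" using T d by (auto simp: hall_def)
  let ?B = "column T d" and ?B' = "column ?T' d"
  have fin: "finite T" using T by (simp add: hall_def)
  have col: "column ?T' c = (if c = d then insert v (?B - {y}) else column T c)" for c
    using y v by (auto simp: column_def)
  have above': "above ?B' z + (if z \<le> y then 1 else 0) = above ?B z + (if z \<le> v then 1 else 0)" for z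
    using above_remove[of ?B y z] above_insert[of "?B - {y}" v z] fin v y
    unfolding col by simp
  fix c :: nat assume c: "1 \<le> c"
  have dom: "above (column T (Suc c)) z \<le> above (column T c) z" for z
    using T c by (auto simp: hall_def dom_le_def)
  show "dom_le (column ?T' (Suc c)) (column ?T' c)"
    unfolding dom_le_def
  proof
    fix z
    consider "c = d" | "Suc c = d" "y < z" "z \<le> v" | "Suc c = d" "z \<le> y \<or> v < z" | "c \<noteq> d" "Suc c \<noteq> d"
      by linarith
    then show "above (column ?T' (Suc c)) z \<le> above (column ?T' c) z"
    proof cases
      case 1
      have "above (column ?T' (Suc c)) z = above (column T (Suc c)) z" using 1 by (simp only: col) simp
      then show ?thesis using dom[of z] above'[of z] y 1 by (auto split: if_splits)
    next
      case 2
      have "above ?B z = above ?B v"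
      proof (rule above_eq_gap)
        show "v \<le> x" if "x \<in> ?B" "z \<le> x" for x
          using y(3)[OF that(1)] that(2) 2 by (cases "x < v") auto
      qed (use 2 in simp)
      then have "above ?B' z \<le> above (column T c) v"
        using slack c 2 above'[of z] by (auto simp: slack_def)
      also have "\<dots> \<le> above (column T c) z" using 2 fin by (intro above_antimono) auto
      also have "column T c = column ?T' c" using 2 by (simp only: col) simp
      finally show ?thesis using 2 by simp
    next
      case 3
      have "column T c = column ?T' c" using 3 by (simp only: col) simp
      then show ?thesis using dom[of z] above'[of z] y 3 by (auto split: if_splits)
    next
      case 4
      then show ?thesis using dom[of z] by (simp only: col if_False)
    qed
  qed
qed

text \<open>Induction along the bumps in column \<open>d\<close>. Bumping \<open>x\<close> changes
  counts only at thresholds above \<open>x\<close>, so \<open>slack\<close> at \<open>x\<close> and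
  below is inherited. Without \<open>slack\<close> at \<open>v\<close>, both claims are
  vacuous.\<close>

lemma insert_column_multi_aux:
  assumes "hall T" "column T d \<subseteq> {1..N}" "1 \<le> d" "v \<notin> column T d" "1 \<le> v" "v \<le> N"
  shows "(y \<in> column T d \<and> y < v \<and> (\<forall>z. y < z \<and> z \<le> v \<longrightarrow> slack T d z) \<longrightarrow>
      insert_column N T d v = insert_column N (insert (d, v) (T - {(d, y)})) d y) \<and>
    ((\<forall>z\<le>v. slack T d z) \<longrightarrow> insert_column N T d v = phi N (insert (d, v) T))"
  using assms
proof (induction v arbitrary: T rule: less_induct)
  case (less v)
  note T = less.prems
  show ?case
  proof (cases "slack T d v \<and> (\<exists>x\<in>column T d. x < v)")
    case False
    have "insert_column N T d v = phi N (insert (d, v) T)" if "slack T d v"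
    proof (rule insert_column_end[OF T(1-3) that T(4-6)])
      show "v < x" if "x \<in> column T d" for x
        using that False \<open>slack T d v\<close> T(4) by (cases x v rule: linorder_cases) auto
    qed
    then show ?thesis using False by auto
  next
    case True
    have fin: "finite T" using T(1) by (simp add: hall_def)
    define x where "x = Max {x \<in> column T d. x < v}"
    have "x \<in> {x \<in> column T d. x < v}"
      unfolding x_def using fin True by (intro Max_in) auto
    then have x: "x \<in> column T d" "x < v" by auto
    have x_max: "x' \<le> x" if "x' \<in> column T d" "x' < v" for x'
      unfolding x_def using fin that by (intro Max_ge) auto
    define T' where "T' = insert (d, v) (T - {(d, x)})"
    have step: "insert_column N T d v = insert_column N T' d x"
      unfolding T'_def using insert_column_bump(1)[OF T(1,2) _ T(4-6) x x_max] True by blast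
    have above': "above (column T' d) z + (if z \<le> x then 1 else 0) = above (column T d) z + (if z \<le> v then 1 else 0)" for z
      unfolding T'_def using insert_column_bump(2)[OF T(1,2) _ T(4-6) x x_max] True by blast
    have hall': "hall T'"
      unfolding T'_def using hall_bump[OF T(1,3) _ T(4) x x_max] True by blast
    have col: "column T' c = (if c = d then insert v (column T d - {x}) else column T c)" for c
      using x by (auto simp: T'_def column_def)
    have slack': "slack T' d z" if "slack T d z" "z \<le> x" for z
    proof -
      have "above (column T' d) z = above (column T d) z" using above'[of z] that x by simp
      moreover have "column T' (d - 1) = column T (d - 1)" unfolding col using T(3) by auto
      ultimately show ?thesis using that(1) by (simp add: slack_def)
    qed
    have xN: "1 \<le> x" "x \<le> N" using x T(2) by auto
    have "column T' d \<subseteq> {1..N}" "x \<notin> column T' d" using T x by (auto simp: col)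
    note IH = less.IH[OF x(2) hall' this(1) T(3) this(2) xN]
    \<comment> \<open>The intermediate cell \<open>x\<close> is taken out by one bump and put back
      by the next.\<close>
    have swap: "insert (d, x) (T' - S) = insert (d, v) (T - S)" if "(d, v) \<notin> S" "(d, x) \<notin> S" for S
      using x(1) that by (auto simp: T'_def mem_column)
    show ?thesis
    proof (intro conjI impI)
      assume y: "y \<in> column T d \<and> y < v \<and> (\<forall>z. y < z \<and> z \<le> v \<longrightarrow> slack T d z)"
      show "insert_column N T d v = insert_column N (insert (d, v) (T - {(d, y)})) d y"
      proof (cases "y = x")
        case True
        then show ?thesis using step by (simp add: T'_def)
      next
        case False
        then have "y < x" "y \<in> column T' d" using y x_max[of y] by (auto simp: col)
        then have "insert_column N T' d x = insert_column N (insert (d, x) (T' - {(d, y)})) d y"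
          using IH y x(2) slack' by auto
        then show ?thesis using step swap[of "{(d, y)}"] y False by simp
      qed
    next
      assume "\<forall>z\<le>v. slack T d z"
      then have "insert_column N T' d x = phi N (insert (d, x) T')"
        using IH x(2) slack' by auto
      then show "insert_column N T d v = phi N (insert (d, v) T)"
        using step swap[of "{}"] by simp
    qed
  qed
qed

lemma insert_column_multi:
  assumes "hall T" "column T d \<subseteq> {1..N}" "1 \<le> d" "v \<notin> column T d" "1 \<le> v" "v \<le> N"
    and "y \<in> column T d" "y < v" "\<And>z. y < z \<Longrightarrow> z \<le> v \<Longrightarrow> slack T d z"
  shows "insert_column N T d v = insert_column N (insert (d, v) (T - {(d, y)})) d y"
  using insert_column_multi_aux[OF assms(1-6), of y] assms(7-9) by simp

lemma insert_column_stop: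
  assumes "hall T" "column T d \<subseteq> {1..N}" "1 \<le> d" "v \<notin> column T d" "1 \<le> v" "v \<le> N"
    and "\<And>z. z \<le> v \<Longrightarrow> slack T d z"
  shows "insert_column N T d v = phi N (insert (d, v) T)"
  using insert_column_multi_aux[OF assms(1-6)] assms(7) by simp


section \<open>Rectification\<close>

lemma semi_properD:
  assumes "semi_proper \<alpha> T L"
  shows "1 \<le> c \<Longrightarrow> bij_betw (\<lambda>i. L (c, i)) (column T c) (labels_ge \<alpha> c)"
    and "(c, i) \<in> T \<Longrightarrow> i \<le> L (c, i)"
    and "(c, i) \<in> T \<Longrightarrow> (c', i') \<in> T \<Longrightarrow> c < c' \<Longrightarrow> L (c, i) = L (c', i') \<Longrightarrow> i' \<le> i"
  using assms unfolding semi_proper_def labels_ge_def by blast+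

section \<open>Abutting expressed by counts of cells\<close>

lemma mem_labels_ge_iff:
  assumes "semi_proper \<alpha> T L" "1 \<le> c"
  shows "r \<in> labels_ge \<alpha> c \<longleftrightarrow> (\<exists>i. (c, i) \<in> T \<and> L (c, i) = r)"
  using bij_betw_imp_surj_on[OF semi_properD(1)[OF assms]] by (force simp: column_def)

lemma labels_ge_antimono: "c \<le> c' \<Longrightarrow> labels_ge \<alpha> c' \<subseteq> labels_ge \<alpha> c"
  by (auto simp: labels_ge_def)

text \<open>For a semi-proper labeling these sets grow from right to left and have
  \<open>above (column T c) z\<close> elements, so a strict inequality of counts yields an actual
  label.\<close>

definition labels_above :: "diagram \<Rightarrow> labeling \<Rightarrow> nat \<Rightarrow> nat \<Rightarrow> nat set" where
  "labels_above T L c z = (\<lambda>i. L (c, i)) ` {i \<in> column T c. z \<le> i}"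

lemma mem_labels_above: "r \<in> labels_above T L c z \<longleftrightarrow> (\<exists>i\<ge>z. (c, i) \<in> T \<and> L (c, i) = r)"
  by (auto simp: labels_above_def column_def)

lemma labels_aboveI:
  "(c, i) \<in> T \<Longrightarrow> L (c, i) = r \<Longrightarrow> v \<le> i \<Longrightarrow> z \<le> v \<Longrightarrow> r \<in> labels_above T L c z"
  using mem_labels_above le_trans by blast

lemma card_labels_above:
  assumes "semi_proper \<alpha> T L" "1 \<le> c"
  shows "card (labels_above T L c z) = above (column T c) z"
proof -
  have "inj_on (\<lambda>i. L (c, i)) (column T c)"
    using semi_properD(1)[OF assms] by (rule bij_betw_imp_inj_on)
  then have "inj_on (\<lambda>i. L (c, i)) {i \<in> column T c. z \<le> i}" by (rule inj_on_subset) auto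
  then show ?thesis by (simp add: labels_above_def above_def card_image)
qed

lemma labels_above_mono:
  assumes "semi_proper \<alpha> T L" "1 \<le> c"
  shows "labels_above T L (Suc c) z \<subseteq> labels_above T L c z"
proof
  fix r assume "r \<in> labels_above T L (Suc c) z"
  then obtain i where i: "z \<le> i" "(Suc c, i) \<in> T" "L (Suc c, i) = r"
    by (auto simp: mem_labels_above)
  then have "r \<in> labels_ge \<alpha> (Suc c)"
    using mem_labels_ge_iff[OF assms(1), of "Suc c"] by auto
  then have "r \<in> labels_ge \<alpha> c" using labels_ge_antimono[of c "Suc c" \<alpha>] by auto
  then obtain j where j: "(c, j) \<in> T" "L (c, j) = r"
    using mem_labels_ge_iff[OF assms] by blast
  then have "i \<le> j" using semi_properD(3)[OF assms(1) j(1) i(2)] i(3) by simp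
  then show "r \<in> labels_above T L c z" unfolding mem_labels_above using i(1) j by (intro exI[of _ j]) simp
qed

lemma finite_labels_above: "finite T \<Longrightarrow> finite (labels_above T L c z)"
  by (simp add: labels_above_def)

lemma hall_if_semi_proper:
  assumes "semi_proper \<alpha> T L" "finite T" "\<forall>(c, i) \<in> T. 1 \<le> c"
  shows "hall T"
  unfolding hall_def
proof (intro conjI allI impI assms)
  fix c :: nat assume c: "1 \<le> c"
  have "above (column T (Suc c)) z \<le> above (column T c) z" for z
    using card_mono[OF finite_labels_above labels_above_mono, OF assms(2,1) c, of z]
      card_labels_above[OF assms(1) c] card_labels_above[OF assms(1), of "Suc c"] by simp
  then show "dom_le (column T (Suc c)) (column T c)" by (simp add: dom_le_def)
qed

text \<open>The label \<open>r\<close> occurs weakly above \<open>z\<close> in column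
  \<open>d - 1\<close> but not in column \<open>d\<close>. Allowing every such \<open>z\<close>, not
  just \<open>v\<close>, is what a run of several bumps requires.\<close>

lemma slack_if_abuts:
  assumes L: "semi_proper \<alpha> T L" "finite T" and d: "1 \<le> d"
    and ab: "abuts \<alpha> T L (d, v) r" and z: "z \<le> v"
    and low: "\<And>j. (d, j) \<in> T \<Longrightarrow> L (d, j) = r \<Longrightarrow> j < z"
  shows "slack T d z"
proof (cases "d = 1")
  case False
  then obtain c where c: "d = Suc c" "1 \<le> c" using d by (cases d) auto
  have "r \<notin> labels_above T L d z"
  proof
    assume "r \<in> labels_above T L d z"
    then obtain j where "z \<le> j" "(d, j) \<in> T" "L (d, j) = r" by (auto simp: mem_labels_above)
    then show False using low[of j] by simp
  qed
  moreover have "r \<in> labels_above T L c z"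
    using ab c z unfolding abuts_def mem_labels_above by (auto intro: le_trans labels_aboveI)
  ultimately have "labels_above T L d z \<subset> labels_above T L c z"
    using labels_above_mono[OF L(1) c(2), of z] c(1) by blast
  then have "card (labels_above T L d z) < card (labels_above T L c z)"
    by (rule psubset_card_mono[OF finite_labels_above[OF L(2)]])
  then show ?thesis using card_labels_above[OF L(1)] c by (simp add: slack_def)
qed (simp add: slack_def)

text \<open>A label found weakly above \<open>v\<close> only in column \<open>d - 1\<close> either
  ends there or has its cell of column \<open>d\<close> below \<open>v\<close>.\<close>

lemma abuts_if_slack:
  assumes L: "semi_proper \<alpha> T L" "finite T" and d: "2 \<le> d" and slack: "slack T d v"
    and v: "(d, v) \<notin> T"
  shows "\<exists>r \<le> length \<alpha>. abuts \<alpha> T L (d, v) r"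
proof -
  obtain c where c: "d = Suc c" "1 \<le> c" using d by (cases d) auto
  have "card (labels_above T L d v) < card (labels_above T L c v)"
    using slack c card_labels_above[OF L(1)] by (simp add: slack_def)
  then have "\<not> labels_above T L c v \<subseteq> labels_above T L d v"
    using card_mono[OF finite_labels_above[OF L(2)]] by (metis not_le)
  then obtain r where r: "r \<in> labels_above T L c v" "r \<notin> labels_above T L d v" by blast
  then obtain j where j: "v \<le> j" "(c, j) \<in> T" "L (c, j) = r" by (auto simp: mem_labels_above)
  then have "r \<in> labels_ge \<alpha> c"
    using mem_labels_ge_iff[OF L(1) c(2)] by blast
  then have rc: "c \<le> part \<alpha> r" "r \<le> length \<alpha>" "1 \<le> r" by (auto simp: labels_ge_def)
  have "part \<alpha> r = c \<or> (\<exists>j<v. (d, j) \<in> T \<and> L (d, j) = r)"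
  proof (cases "part \<alpha> r = c")
    case False
    then have "r \<in> labels_ge \<alpha> d" using rc c by (simp add: labels_ge_def)
    then obtain i where "(d, i) \<in> T" "L (d, i) = r"
      using mem_labels_ge_iff[OF L(1), of d] c by auto
    then show ?thesis using r(2) by (auto simp: mem_labels_above not_le)
  qed simp
  then have "abuts \<alpha> T L (d, v) r" using j c by (auto simp: abuts_def Let_def)
  then show ?thesis using rc by blast
qed

text \<open>Lifting \<open>r\<close> from \<open>j\<close> to \<open>v\<close> is safe: its cell in
  column \<open>d - 1\<close> is weakly above \<open>v\<close>, and its cells further right are
  weakly below \<open>j\<close>.\<close>

lemma semi_proper_move:
  assumes L: "semi_proper \<alpha> T L" and d: "2 \<le> d" and v: "(d, v) \<notin> T"
    and ab: "abuts \<alpha> T L (d, v) r" and j: "(d, j) \<in> T" "L (d, j) = r" "j < v"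
  shows "semi_proper \<alpha> (insert (d, v) (T - {(d, j)})) (L((d, v) := r))"
    (is "semi_proper \<alpha> ?T' ?L'")
proof -
  obtain c where c: "d = Suc c" "1 \<le> c" using d by (cases d) auto
  obtain a where a: "v \<le> a" "(c, a) \<in> T" "L (c, a) = r" using ab c by (auto simp: abuts_def)
  have col: "column ?T' k = (if k = d then insert v (column T d - {j}) else column T k)" for k
    using j by (auto simp: column_def)
  have T: "(k, i) \<in> ?T' \<longleftrightarrow> k = d \<and> i = v \<or> (k, i) \<in> T \<and> \<not> (k = d \<and> i = j)" for k i by auto
  have L': "?L' (k, i) = L (k, i)" if "(k, i) \<in> T" for k i using that v by auto
  have "bij_betw (\<lambda>i. ?L' (k, i)) (column ?T' k) (labels_ge \<alpha> k)" if k: "1 \<le> k" for k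
  proof (cases "k = d")
    case False
    then show ?thesis using semi_properD(1)[OF L k] by (simp only: col fun_upd_apply) simp
  next
    case True
    have b: "bij_betw (\<lambda>i. L (d, i)) (column T d) (labels_ge \<alpha> d)"
      using semi_properD(1)[OF L, of d] c by simp
    have "j \<in> column T d" "v \<notin> column T d" using j v by (auto simp: mem_column)
    have "bij_betw (\<lambda>i. ?L' (d, i)) (column T d - {j}) (labels_ge \<alpha> d - {r})"
    proof -
      have "bij_betw (\<lambda>i. L (d, i)) (column T d - {j}) (labels_ge \<alpha> d - {r})"
        using bij_betw_DiffI[OF b, of "{j}" "{r}"] \<open>j \<in> column T d\<close> j(2) b
        by (auto simp: bij_betw_def)
      moreover have "?L' (d, i) = L (d, i)" if "i \<in> column T d - {j}" for i
        using that \<open>v \<notin> column T d\<close> by auto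
      ultimately show ?thesis
        using bij_betw_cong[of "column T d - {j}" "\<lambda>i. ?L' (d, i)" "\<lambda>i. L (d, i)"] by blast
    qed
    moreover have "r \<in> labels_ge \<alpha> d" using b \<open>j \<in> column T d\<close> j(2) by (auto simp: bij_betw_def)
    ultimately have "bij_betw (\<lambda>i. ?L' (d, i)) (insert v (column T d - {j})) (insert r (labels_ge \<alpha> d - {r}))"
      using \<open>v \<notin> column T d\<close> by (auto simp: bij_betw_def)
    then show ?thesis using True \<open>r \<in> labels_ge \<alpha> d\<close> by (simp only: col insert_absorb insert_Diff simp_thms if_True)
  qed
  moreover have "i \<le> ?L' (k, i)" if "(k, i) \<in> ?T'" for k i
  proof (cases "k = d \<and> i = v")
    case True
    then show ?thesis using a semi_properD(2)[OF L a(2)] by simp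
  next
    case False
    then show ?thesis using that T L' semi_properD(2)[OF L] by metis
  qed
  moreover have "i' \<le> i" if ki: "(k, i) \<in> ?T'" "(k', i') \<in> ?T'" "k < k'" "?L' (k, i) = ?L' (k', i')" for k i k' i'
  proof -
    consider "k = d" "i = v" | "k' = d" "i' = v" "(k, i) \<in> T" | "(k, i) \<in> T" "(k', i') \<in> T"
      using ki T by blast
    then show ?thesis
    proof cases
      case 1
      then have "(k', i') \<in> T" using ki T by auto
      then have "L (d, j) = L (k', i')" using 1 ki L' j by simp
      then have "i' \<le> j" using semi_properD(3)[OF L j(1) \<open>(k', i') \<in> T\<close>] 1 ki by simp
      then show ?thesis using 1 j by simp
    next
      case 2
      then have eq: "L (k, i) = L (c, a)" using ki L' a by simp
      show ?thesis
      proof (cases "k = c")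
        case True
        have "i \<in> column T c" "a \<in> column T c" using 2 True a by (auto simp: mem_column)
        then have "i = a"
          using bij_betw_imp_inj_on[OF semi_properD(1)[OF L c(2)]] eq True by (auto dest: inj_onD)
        then show ?thesis using a 2 by simp
      next
        case False
        then have "k < c" using 2 ki c by simp
        then have "a \<le> i" using semi_properD(3)[OF L 2(3) a(2)] eq by simp
        then show ?thesis using a 2 by simp
      qed
    next
      case 3
      then show ?thesis using ki L' semi_properD(3)[OF L] by metis
    qed
  qed
  ultimately show ?thesis unfolding semi_proper_def labels_ge_def by blast
qed

text \<open>The induction follows the termination measure of \<open>Rect\<close> and carries an
  arbitrary labeling of an admissible shape. Its existence rules out the branch with value
  \<open>undefined\<close>.\<close>

lemma phi_Rect:
  assumes "\<alpha>' \<preceq>\<^sup>0 \<alpha>" "semi_proper \<alpha>' T L" "finite T" "T \<subseteq> {1..} \<times> {1..N}"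
    and "labels_ge \<alpha> 1 = column T 1" "length \<alpha> \<le> k" "k \<le> N"
    and "1 \<le> d" "1 \<le> i" "i \<le> k" "(d, i) \<notin> T"
  shows "phi N (Rect k \<alpha> T (d, i)) = insert_column N T d i"
  using assms
proof (induction "d + i" arbitrary: \<alpha>' T L d i rule: less_induct)
  case less
  note le = less.prems(1) and L = less.prems(2) and fin = less.prems(3) and T = less.prems(4)
    and supp = less.prems(5) and k = less.prems(6,7) and d = less.prems(8)
    and i = less.prems(9,10) and vac = less.prems(11)
  have hall: "hall T" using hall_if_semi_proper[OF L fin] T by auto
  have colN: "column T d \<subseteq> {1..N}" using T by (auto simp: mem_column)
  have i': "i \<notin> column T d" "i \<le> N" using vac i k by (auto simp: mem_column)
  note column_facts = hall colN d i'(1) i(1) i'(2)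
  let ?C1 = "\<exists>\<alpha>' L r. \<alpha>' \<preceq>\<^sup>0 \<alpha> \<and> semi_proper \<alpha>' T L \<and> r \<le> k \<and> abuts \<alpha>' T L (d, i) r \<and>
    part \<alpha>' r = d - 1"
  let ?C2 = "\<exists>\<alpha>' L r. \<alpha>' \<preceq>\<^sup>0 \<alpha> \<and> semi_proper \<alpha>' T L \<and> r \<le> k \<and> abuts \<alpha>' T L (d, i) r"
  \<comment> \<open>A vacant position of column 1 has part 0 in every admissible shape, so it abuts
    its own row index as rightmost label and \<open>Rect\<close> stops.\<close>
  have C1: ?C1 if "d = 1"
  proof (intro exI conjI)
    have "i \<notin> labels_ge \<alpha>' 1" using i'(1) supp pinned_swap_le_support[OF le] that by simp
    then have "part \<alpha>' i = 0" using i by (auto simp: labels_ge_def part_def)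
    then show "part \<alpha>' i = d - 1" "abuts \<alpha>' T L (d, i) i" using that by (auto simp: abuts_def)
  qed (rule le L i)+
  show ?case
  proof (cases ?C1)
    case True
    then obtain \<alpha>'' L' r where L': "semi_proper \<alpha>'' T L'" "abuts \<alpha>'' T L' (d, i) r" "part \<alpha>'' r = d - 1"
      by blast
    \<comment> \<open>The label is absent from column \<open>d\<close>, so \<open>slack\<close>
      holds at every threshold up to \<open>i\<close> and the insertion runs to its end within this
      column.\<close>
    have "r \<notin> labels_ge \<alpha>'' d" using L'(3) d by (auto simp: labels_ge_def)
    then have "L' (d, j) \<noteq> r" if "(d, j) \<in> T" for j
      using mem_labels_ge_iff[OF L'(1) d] that by blast
    then have "slack T d z" if "z \<le> i" for z
      using slack_if_abuts[OF L'(1) fin d L'(2) that] by blast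
    then have "insert_column N T d i = phi N (insert (d, i) T)" by (rule insert_column_stop[OF column_facts])
    moreover have "Rect k \<alpha> T (d, i) = insert (d, i) T" by (subst Rect.simps) (simp only: True if_True)
    ultimately show ?thesis by simp
  next
    case notC1: False
    then have "d \<noteq> 1" using C1 by blast
    then have d2: "2 \<le> d" using d by simp
    then have col1: "column (insert (d, a) (T - {(d, b)})) 1 = column T 1" for a b
      by (auto simp: column_def)
    show ?thesis
    proof (cases ?C2)
      case True
      let ?P = "\<lambda>j. (d, j) \<in> T \<and> (\<exists>\<alpha>' L r. \<alpha>' \<preceq>\<^sup>0 \<alpha> \<and> semi_proper \<alpha>' T L \<and> r \<le> k \<and>
                                abuts \<alpha>' T L (d, i) r \<and> L (d, j) = r)"
      define j where "j = (LEAST j. ?P j)"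
      obtain \<alpha>0 L0 r0 where L0: "\<alpha>0 \<preceq>\<^sup>0 \<alpha>" "semi_proper \<alpha>0 T L0" "r0 \<le> k" "abuts \<alpha>0 T L0 (d, i) r0"
        using True by blast
      then have "part \<alpha>0 r0 \<noteq> d - 1" using notC1 by blast
      then obtain j0 where "(d, j0) \<in> T" "L0 (d, j0) = r0"
        using L0(4) by (auto simp: abuts_def Let_def)
      then have "?P j0" using L0 by blast
      then have "?P j" unfolding j_def by (rule LeastI)
      \<comment> \<open>This witness for the choice of \<open>j\<close> replaces the carried
        labeling in the recursive call, with \<open>r\<close> passed from \<open>j\<close> to
        \<open>i\<close>.\<close>
      then obtain \<alpha>1 L1 r where L1: "\<alpha>1 \<preceq>\<^sup>0 \<alpha>" "semi_proper \<alpha>1 T L1" "r \<le> k" "abuts \<alpha>1 T L1 (d, i) r"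
        "(d, j) \<in> T" "L1 (d, j) = r" by blast
      have inj: "inj_on (\<lambda>i. L1 (d, i)) (column T d)"
        using bij_betw_imp_inj_on[OF semi_properD(1)[OF L1(2) d]] .
      have uniq: "l = j" if "(d, l) \<in> T" "L1 (d, l) = r" for l
        using inj_onD[OF inj, of l j] that L1 by (simp add: mem_column)
      have "part \<alpha>1 r \<noteq> d - 1" using notC1 L1 by blast
      then have "j < i" using L1(4) uniq by (auto simp: abuts_def Let_def)
      have slack: "slack T d z" if "j < z" "z \<le> i" for z
        using slack_if_abuts[OF L1(2) fin d L1(4) that(2)] uniq that(1) by blast
      let ?T' = "insert (d, i) (T - {(d, j)})"
      have "Rect k \<alpha> T (d, i) = Rect k \<alpha> (insert (d, i) T - {(d, j)}) (d, j)"
        by (subst Rect.simps) (simp only: notC1 True if_True if_False Let_def j_def)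
      also have "insert (d, i) T - {(d, j)} = ?T'" using \<open>j < i\<close> by auto
      also have "phi N (Rect k \<alpha> ?T' (d, j)) = insert_column N ?T' d j"
      proof (rule less.hyps[OF _ L1(1) semi_proper_move[OF L1(2) d2 vac L1(4-6) \<open>j < i\<close>]])
        show "?T' \<subseteq> {1..} \<times> {1..N}" using T d i k by auto
        show "1 \<le> j" using L1(5) T by auto
        show "labels_ge \<alpha> 1 = column ?T' 1" using supp col1 by simp
      qed (use fin k d i \<open>j < i\<close> in auto)
      also have "\<dots> = insert_column N T d i"
        using insert_column_multi[OF column_facts, of j] L1(5) \<open>j < i\<close> slack by (simp add: mem_column)
      finally show ?thesis .
    next
      case notC2: False
      have d1: "1 \<le> d - 1" "d - 1 \<le> d" using d2 by simp_all
      have "\<not> slack T d i"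
      proof
        assume "slack T d i"
        then obtain r where "r \<le> length \<alpha>'" "abuts \<alpha>' T L (d, i) r"
          using abuts_if_slack[OF L fin d2 _ vac] by blast
        moreover from this have "r \<le> k" using pinned_swap_le_support[OF le] k by simp
        ultimately show False using notC2 le L by blast
      qed
      then have eq: "above (column T d) i = above (column T (d - 1)) i"
        using hall_above_mono[OF hall d1, of i] d2 by (simp add: slack_def)
      \<comment> \<open>A cell there would make column \<open>d - 1\<close> drop below column
        \<open>d\<close> at threshold \<open>i + 1\<close>, against \<open>hall\<close>. So
        \<open>Rect\<close> moves by exactly one column.\<close>
      have vac': "(d - 1, i) \<notin> T"
      proof
        assume "(d - 1, i) \<in> T"
        then have "above (column T (d - 1)) i = Suc (above (column T (d - 1)) (Suc i))"
          using above_Suc[of "column T (d - 1)" i] fin by (simp add: mem_column)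
        moreover have "above (column T d) i = above (column T d) (Suc i)"
          using above_Suc[of "column T d" i] fin i'(1) by simp
        ultimately show False using eq hall_above_mono[OF hall d1, of "Suc i"] by simp
      qed
      let ?V = "{c. 1 \<le> c \<and> c < d \<and> (c, i) \<notin> T}"
      have in_V: "d - 1 \<in> ?V" using vac' d2 by auto
      have ex: "\<exists>c. 1 \<le> c \<and> c < d \<and> (c, i) \<notin> T" using in_V by blast
      have Max: "Max ?V = d - 1" using in_V by (intro Max_eqI) auto
      have "Rect k \<alpha> T (d, i) = Rect k \<alpha> T (d - 1, i)"
        by (subst Rect.simps) (simp only: notC1 notC2 ex Max if_True if_False)
      moreover have "phi N (Rect k \<alpha> T (d - 1, i)) = insert_column N T (d - 1) i"
        using d2 vac' by (intro less.hyps[OF _ le L fin T supp k _ i]) auto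
      \<comment> \<open>\<open>insert_column\<close> depends on the column only through the count at
        \<open>i\<close>, and the two counts agree.\<close>
      ultimately show ?thesis by (simp add: insert_column_def eq)
    qed
  qed
qed

text \<open>Kohnert moves keep column sizes, so the column just beyond the largest part is empty.
  Its count is 0, and \<open>insert_column\<close> starts in the top row \<open>N\<close>.\<close>

lemma phi_kd_insert:
  fixes \<alpha> :: composition and T :: diagram and k r N :: nat
  assumes "T \<in> KD \<alpha>" and "length \<alpha> \<le> k" and "1 \<le> r" and "r \<le> k" and "k \<le> N"
  shows "phi N (kd_insert \<alpha> k T r) = insert_from_row N (phi N T) r"
proof -
  let ?d = "Max (insert 0 (set \<alpha>)) + 1"
  let ?\<gamma> = "insertion_shape \<alpha> T"
  have inv: "kohnert_inv \<alpha> T" using assms(1) by (rule KD_kohnert_inv)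
  then have T: "T \<subseteq> {1..} \<times> {1..length \<alpha>}" "finite T" by (auto simp: kohnert_inv_def)
  obtain L where L: "semi_proper (theta (length \<alpha>) T) T L" using theta_semi_proper[OF inv] by blast
  note shape = insertion_shape_ge_theta[OF inv]
  have "\<not> ?d \<le> part \<alpha> i" for i
  proof (cases "1 \<le> i \<and> i \<le> length \<alpha>")
    case True
    then have "\<alpha> ! (i - 1) \<le> Max (insert 0 (set \<alpha>))" by (intro Max_ge) auto
    then show ?thesis using True by (simp add: part_def)
  qed (auto simp: part_def)
  then have "labels_ge \<alpha> ?d = {}" by (auto simp: labels_ge_def)
  moreover have "card (column T ?d) = card (labels_ge \<alpha> ?d)"
    using inv unfolding kohnert_inv_def by simp
  ultimately have empty: "column T ?d = {}" using T(2) by simp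
  have "phi N (kd_insert \<alpha> k T r) = insert_column N T ?d r"
    unfolding kd_insert_def
  proof (rule phi_Rect[OF shape L T(2)])
    show "labels_ge ?\<gamma> 1 = column T 1" "length ?\<gamma> \<le> k"
      using theta_support[OF inv] pinned_swap_le_support[OF shape] assms(2) by simp_all
    show "(?d, r) \<notin> T" using empty mem_column by blast
    have "{1..length \<alpha>} \<subseteq> {1..N}" using assms(2,5) by simp
    then show "T \<subseteq> {1..} \<times> {1..N}" using T(1) by blast
  qed (use assms in auto)
  also have "\<dots> = insert_from_row N (phi N T) r"
    unfolding insert_column_def empty by (simp add: above_def)
  finally show ?thesis .
qed

theorem theorem3p10:
  fixes \<alpha> :: composition and T :: diagram and k r N :: nat
  assumes "T \<in> KD \<alpha>" and "length \<alpha> \<le> k" and "1 \<le> r" and "r \<le> k" and "k \<le> N"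
  shows "phi N (kd_insert \<alpha> k T r) = rsk_insert N (phi N T) r"
  unfolding rsk_insert_def using assms by (rule phi_kd_insert)

end
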